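(* Let $\alpha>-1$ be real, let $k\in\{3,4,5,6\}$, and let $n\ge k$ be an integer. Then the best constant $c_n(\alpha)$ in the Markov inequality $\|p'\|_{w_\alpha}\le c_n(\alpha)\|p\|_{w_\alpha}$, $p\in\mathcal P_n$, satisfies $$\underline{c}_{\,n,k}(\alpha)\le c_n(\alpha)\le \overline{c}_{n,k}(\alpha),$$ where $\underline{c}_{\,n,k}(\alpha),\overline{c}_{n,k}(\alpha)$ are the positive numbers whose squares are $$\underline{c}_{\,n,3}^2(\alpha)=\frac{2\,n\big(n+\frac{3(\alpha+1)}{8}\big)}{(\alpha+1)(\alpha+5)},$$ $$\overline{c}_{n,3}^{\,2}(\alpha)=\frac{(n+1)\big(n+\frac{2(\alpha+1)}{5}\big)}{(\alpha+1)\big[(\alpha+3)(\alpha+5)\big]^{1/3}},$$ $$\underline{c}_{\,n,4}^2(\alpha)=\frac{(5\alpha+17)\,n\big(n+\frac{8(\alpha+1)}{25}\big)}{2(\alpha+1)(\alpha+3)(\alpha+7)},$$ $$\overline{c}_{n,4}^{\,2}(\alpha)=\frac{(5\alpha+17)^{1/4}(n+1)\big(n+\frac{3(\alpha+1)}{7}\big)}{(\alpha+1)(\alpha+3)^{1/2}\big[2(\alpha+5)(\alpha+7)\big]^{1/4}},$$ $$\underline{c}_{\,n,5}^2(\alpha)=\frac{2(7\alpha+31)\,n\big(n+\frac{25(\alpha+1)}{84}\big)}{(\alpha+1)(\alpha+9)(5\alpha+17)},$$ $$\overline{c}_{n,5}^{\,2}(\alpha)=\frac{(7\alpha+31)^{1/5}(n+1)\big(n+\frac{4(\alpha+1)}{9}\big)}{(\alpha+1)(\alpha+3)^{2/5}\big[(\alpha+5)(\alpha+7)(\alpha+9)\big]^{1/5}},$$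 $$\underline{c}_{\,n,6}^2(\alpha)=\frac{\big(21\alpha^3+299\alpha^2+1391\alpha+2073\big)\,n\big(n+\frac{2(\alpha+1)}{7}\big)}{(\alpha+1)(\alpha+3)(\alpha+5)(\alpha+11)(7\alpha+31)},$$ $$\overline{c}_{n,6}^{\,2}(\alpha)=\frac{\big(21\alpha^3+299\alpha^2+1391\alpha+2073\big)^{1/6}(n+1)\big(n+\frac{5(\alpha+1)}{11}\big)}{(\alpha+1)(\alpha+3)^{1/2}(\alpha+5)^{1/3}\big[(\alpha+7)(\alpha+9)(\alpha+11)\big]^{1/6}}.$$
   Context: $\mathcal P_n$ denotes the set of algebraic polynomials of degree at most $n$ with real coefficients. For $\alpha>-1$, $w_\alpha(x):=x^{\alpha}e^{-x}$ is the Laguerre weight on $(0,\infty)$ and $\|f\|_{w_\alpha}:=\big(\int_0^\infty |f(x)|^2w_\alpha(x)\,dx\big)^{1/2}$. The best (smallest possible) Markov constant is $c_n(\alpha):=\sup_{p\in\mathcal P_n,\ p\ne0}\dfrac{\|p'\|_{w_\alpha}}{\|p\|_{w_\alpha}}$. *)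

theory Defs
  imports "HOL-Analysis.Analysis" "HOL-Computational_Algebra.Polynomial"
begin

definition laguerre_weight :: "real \<Rightarrow> real \<Rightarrow> real" where
  "laguerre_weight \<alpha> x = x powr \<alpha> * exp (- x)"

definition laguerre_norm :: "real \<Rightarrow> (real \<Rightarrow> real) \<Rightarrow> real" where
  "laguerre_norm \<alpha> f =
     sqrt (LINT x:{0<..}|lborel. \<bar>f x\<bar>\<^sup>2 * laguerre_weight \<alpha> x)"

text \<open>The supremum is taken in the extended reals, so that an upper bound on the Markov constant
  includes its finiteness.\<close>

definition markov_const :: "nat \<Rightarrow> real \<Rightarrow> ereal" where
  "markov_const n \<alpha> =
     (SUP p \<in> {p :: real poly. degree p \<le> n \<and> p \<noteq> 0}.
        ereal (laguerre_norm \<alpha> (poly (pderiv p)) / laguerre_norm \<alpha> (poly p)))"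

text \<open>Squares of the bounds. The value for \<open>k\<close> outside \<open>{3, 4, 5, 6}\<close> is irrelevant.
  For \<open>\<alpha> > -1\<close> all bases of the real powers are positive.\<close>

definition markov_lower_sq :: "nat \<Rightarrow> nat \<Rightarrow> real \<Rightarrow> real" where
  "markov_lower_sq n k \<alpha> =
    (if k = 3 then
       2 * real n * (real n + 3 * (\<alpha> + 1) / 8) / ((\<alpha> + 1) * (\<alpha> + 5))
     else if k = 4 then
       (5 * \<alpha> + 17) * real n * (real n + 8 * (\<alpha> + 1) / 25)
         / (2 * (\<alpha> + 1) * (\<alpha> + 3) * (\<alpha> + 7))
     else if k = 5 then
       2 * (7 * \<alpha> + 31) * real n * (real n + 25 * (\<alpha> + 1) / 84)
         / ((\<alpha> + 1) * (\<alpha> + 9) * (5 * \<alpha> + 17))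
     else if k = 6 then
       (21 * \<alpha> ^ 3 + 299 * \<alpha> ^ 2 + 1391 * \<alpha> + 2073) * real n * (real n + 2 * (\<alpha> + 1) / 7)
         / ((\<alpha> + 1) * (\<alpha> + 3) * (\<alpha> + 5) * (\<alpha> + 11) * (7 * \<alpha> + 31))
     else undefined)"

definition markov_upper_sq :: "nat \<Rightarrow> nat \<Rightarrow> real \<Rightarrow> real" where
  "markov_upper_sq n k \<alpha> =
    (if k = 3 then
       (real n + 1) * (real n + 2 * (\<alpha> + 1) / 5)
         / ((\<alpha> + 1) * ((\<alpha> + 3) * (\<alpha> + 5)) powr (1 / 3))
     else if k = 4 then
       (5 * \<alpha> + 17) powr (1 / 4) * (real n + 1) * (real n + 3 * (\<alpha> + 1) / 7)
         / ((\<alpha> + 1) * (\<alpha> + 3) powr (1 / 2) * (2 * (\<alpha> + 5) * (\<alpha> + 7)) powr (1 / 4))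
     else if k = 5 then
       (7 * \<alpha> + 31) powr (1 / 5) * (real n + 1) * (real n + 4 * (\<alpha> + 1) / 9)
         / ((\<alpha> + 1) * (\<alpha> + 3) powr (2 / 5)
            * ((\<alpha> + 5) * (\<alpha> + 7) * (\<alpha> + 9)) powr (1 / 5))
     else if k = 6 then
       (21 * \<alpha> ^ 3 + 299 * \<alpha> ^ 2 + 1391 * \<alpha> + 2073) powr (1 / 6)
         * (real n + 1) * (real n + 5 * (\<alpha> + 1) / 11)
         / ((\<alpha> + 1) * (\<alpha> + 3) powr (1 / 2) * (\<alpha> + 5) powr (1 / 3)
            * ((\<alpha> + 7) * (\<alpha> + 9) * (\<alpha> + 11)) powr (1 / 6))
     else undefined)"

text \<open>For \<open>\<alpha> > -1\<close> and \<open>n \<ge> k\<close> the radicands are positive.\<close>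

definition markov_lower :: "nat \<Rightarrow> nat \<Rightarrow> real \<Rightarrow> real" where
  "markov_lower n k \<alpha> = sqrt (markov_lower_sq n k \<alpha>)"

definition markov_upper :: "nat \<Rightarrow> nat \<Rightarrow> real \<Rightarrow> real" where
  "markov_upper n k \<alpha> = sqrt (markov_upper_sq n k \<alpha>)"

end

theory Submission
  imports Defs "HOL-Computational_Algebra.Fundamental_Theorem_Algebra"
begin

text \<open>
  In the Laguerre basis a polynomial with coefficients \<open>c\<^sub>j\<close> has squared norm
  \<open>\<Sum> h\<^sub>j c\<^sub>j\<^sup>2\<close>, and, since \<open>L\<^sub>j' = - \<Sum>\<^sub>i\<^sub><\<^sub>j L\<^sub>i\<close>, its derivative has squared norm
  \<open>\<Sum> h\<^sub>i v\<^sub>i\<^sup>2\<close> with the tail sums \<open>v\<^sub>i = \<Sum>\<^sub>j\<^sub>>\<^sub>i c\<^sub>j\<close>. So the Markov inequality is a discrete Hardy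
  inequality. The associated three-term recurrence defines a polynomial
  \<open>chi n = \<Prod> (1 + l X)\<close> whose \<open>l\<close> are all positive, and the largest \<open>l\<close> that occurs is the square
  of the best constant.
  The first coefficients of \<open>chi n\<close> are explicit, so Newton's identities give the power sums
  \<open>p\<^sub>k = \<Sum> l\<^sup>k\<close>, and \<open>p\<^sub>k / p\<^sub>k\<^sub>-\<^sub>1 \<le> max l \<le> p\<^sub>k\<^sup>1\<^sup>/\<^sup>k\<close>. What remains are polynomial
  inequalities in \<open>n\<close> and \<open>b = \<alpha> + 1\<close>; after a shift of \<open>n\<close> the differences have nonnegative
  coefficients.
\<close>

section \<open>Laguerre polynomials\<close>

text \<open>The recurrence is the Euler-Lagrange equation of the quotient of
  \<open>\<Sum> h_i v_i^2\<close> by \<open>\<Sum> h_(j+1) (v_j - v_(j+1))^2\<close>. The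
  coefficient c_0 does not enter the tail sums, so the end 0 is free (\<open>dchi 0 = 0\<close>),
  while v_n = 0 fixes the other end: the stationary values 1/\<mu> come from the roots -\<mu> of
  \<open>chi n\<close>. Both directions then follow by summation by parts, without matrices: a root
  gives an extremal polynomial, and a positive solution gives the Hardy inequality. The constants of
  the theorem come from the closed forms. The factor of n^2 is the leading one of p_k / p_(k-1) or
  of p_k^(1/k) as n grows. In the upper bounds the fraction (k-1)/(2k-1) of \<alpha> + 1 makes the
  next coefficient in n agree in its top power of \<alpha> + 1. In the lower bounds the fractions
  3/8, 8/25, 25/84, 2/7 give the behaviour of p_k / p_(k-1) for large \<alpha>, to leading order in
  n. These cancellations leave differences that can be checked by their coefficients.\<close>

lemma has_bochner_integral_laguerre_moment:
  assumes "\<alpha> > -1"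
  shows "has_bochner_integral lborel
           (\<lambda>x. indicator {0<..} x *\<^sub>R (x ^ k * laguerre_weight \<alpha> x)) (Gamma (\<alpha> + 1 + real k))"
proof (rule has_bochner_integral_nn_integral)
  have pos: "\<alpha> + 1 + real k > 0" using assms by simp
  \<comment> \<open>The gamma integral runs over \<open>{0..}\<close> and the weighted one over
    \<open>{0<..}\<close>; the point 0 is a null set.\<close>
  have eq: "ennreal (indicator {0..} x * x powr (\<alpha> + 1 + real k - 1) / exp x) =
        ennreal (indicator {0<..} x *\<^sub>R (x ^ k * laguerre_weight \<alpha> x))" if "x \<noteq> 0" for x :: real
    using that by (auto simp: indicator_def laguerre_weight_def exp_minus field_simps powr_realpow
        powr_add)
  have "nn_integral lborel (\<lambda>x. ennreal (indicator {0<..} x *\<^sub>R (x ^ k * laguerre_weight \<alpha> x)))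
      = nn_integral lborel (\<lambda>x. ennreal (indicator {0..} x * x powr (\<alpha> + 1 + real k - 1) / exp x))"
    by (rule nn_integral_cong_AE) (use AE_lborel_singleton[of "0::real"] eq in \<open>auto elim!:
        eventually_mono\<close>)
  also have "\<dots> = Gamma (\<alpha> + 1 + real k)"
    using Gamma_conv_nn_integral_real[OF pos] by simp
  finally show "nn_integral lborel (\<lambda>x. ennreal (indicator {0<..} x *\<^sub>R (x ^ k * laguerre_weight \<alpha>
      x)))
      = ennreal (Gamma (\<alpha> + 1 + real k))" .
  show "0 \<le> Gamma (\<alpha> + 1 + real k)" using Gamma_real_pos[OF pos] by simp
qed (auto simp: laguerre_weight_def indicator_def)

section \<open>Integration of polynomials against the Laguerre weight\<close>

locale laguerre =
  fixes \<alpha> :: real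
  assumes \<alpha>: "\<alpha> > -1"
begin

definition lint :: "real poly \<Rightarrow> real" where
  "lint p = (LINT x:{0<..}|lborel. poly p x * laguerre_weight \<alpha> x)"

lemma set_integrable_poly: "set_integrable lborel {0<..} (\<lambda>x. poly p x * laguerre_weight \<alpha> x)"
proof -
  have "set_integrable lborel {0<..}
          (\<lambda>x. \<Sum>i\<le>degree p. coeff p i * (x ^ i * laguerre_weight \<alpha> x))"
    unfolding set_integrable_def scaleR_sum_right
    by (intro Bochner_Integration.integrable_sum)
      (use has_bochner_integral_laguerre_moment[OF \<alpha>] in
        \<open>auto simp: has_bochner_integral_iff mult.left_commute intro!: integrable_mult_right\<close>)
  then show ?thesis
    by (simp add: poly_altdef sum_distrib_right mult.assoc)
qed

lemma lint_monom: "lint (monom c k) = c * Gamma (\<alpha> + 1 + real k)"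
  using has_bochner_integral_laguerre_moment[OF \<alpha>, of k]
  by (simp add: lint_def poly_monom mult.assoc set_lebesgue_integral_def has_bochner_integral_iff)

lemma lint_add: "lint (p + q) = lint p + lint q"
  unfolding lint_def poly_add distrib_right by (intro set_integral_add set_integrable_poly)

lemma lint_diff: "lint (p - q) = lint p - lint q"
  unfolding lint_def poly_diff left_diff_distrib by (intro set_integral_diff set_integrable_poly)

lemma lint_smult: "lint (smult c p) = c * lint p"
  unfolding lint_def poly_smult mult.assoc by simp

lemma lint_0 [simp]: "lint 0 = 0"
  by (simp add: lint_def)

lemma lint_sum: "lint (\<Sum>i\<in>A. f i) = (\<Sum>i\<in>A. lint (f i))"
  by (induction A rule: infinite_finite_induct) (auto simp: lint_add)

lemma X_mult_pderiv_monom: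
  "[:0, 1:] * pderiv (monom c k) = smult (real k) (monom (c :: real) k)"
proof -
  have "[:0, 1:] = monom (1::real) 1" by (simp add: monom_altdef)
  then show ?thesis
    by (cases k) (auto simp: pderiv_monom mult_monom smult_monom)
qed

text \<open>Integration by parts, verified on monomials with the functional equation of \<open>Gamma\<close>.\<close>

lemma lint_by_parts: "lint ([:0, 1:] * pderiv p + smult (\<alpha> + 1) p - [:0, 1:] * p) = 0"
proof -
  \<comment> \<open>Times the weight, the polynomial in \<open>T p\<close> is the derivative of
    x^(\<alpha>+1) e^(-x) p(x), which vanishes at both ends of the half-line because \<alpha> >
    -1.\<close>
  define T where "T p = lint ([:0, 1:] * pderiv p + smult (\<alpha> + 1) p - [:0, 1:] * p)" for p
  have T_monom: "T (monom c k) = 0" for c k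
  proof -
    have X: "[:0, 1:] = monom (1::real) 1" by (simp add: monom_altdef)
    note X_mult_pderiv_monom[of c k]
    moreover have "[:0, 1:] * monom c k = monom c (Suc k)"
      by (simp add: X mult_monom)
    ultimately have "T (monom c k) = c * ((\<alpha> + 1 + real k) * Gamma (\<alpha> + 1 + real k)
        - Gamma ((\<alpha> + 1 + real k) + 1))"
      by (simp add: T_def lint_add lint_diff lint_smult lint_monom algebra_simps)
    moreover have "\<alpha> + 1 + real k > 0" using \<alpha> by simp
    then have "Gamma ((\<alpha> + 1 + real k) + 1) = (\<alpha> + 1 + real k) * Gamma (\<alpha> + 1 + real k)"
      by (intro Gamma_plus1) (auto elim!: nonpos_Ints_cases)
    ultimately show ?thesis by simp
  qed
  have T_add: "T (p + q) = T p + T q" for p q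
    by (simp add: T_def pderiv_add smult_add_right distrib_left lint_add lint_diff
        del: mult_pCons_left)
  have T_0: "T 0 = 0" by (simp add: T_def)
  have "T (\<Sum>i\<in>A. f i) = (\<Sum>i\<in>A. T (f i))" for A :: "nat set" and f
    by (induction A rule: infinite_finite_induct) (auto simp: T_add T_0)
  then have "T (\<Sum>i\<le>degree p. monom (coeff p i) i) = 0" by (simp add: T_monom)
  then show ?thesis by (simp add: poly_as_sum_of_monoms T_def)
qed

text \<open>The Laguerre polynomials through the raising relation that underlies Rodrigues' formula;
  orthogonality
  then follows by induction from integration by parts.\<close>

primrec lag :: "nat \<Rightarrow> real poly" where
  "lag 0 = 1"
| "lag (Suc j) = smult (1 / (real j + 1))
     (smult (real j + 1 + \<alpha>) (lag j) + [:0, 1:] * (pderiv (lag j) - lag j))"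

lemma lag_Suc: "smult (real j + 1) (lag (Suc j)) =
    smult (real j + 1 + \<alpha>) (lag j) + [:0, 1:] * (pderiv (lag j) - lag j)"
  by simp

declare lag.simps(2) [simp del]

text \<open>Integration by parts for x^m \<open>lag j\<close> turns the raising relation into a
  recursion in j with factor (j - m) / (j + 1), which is that of the signed binomial coefficients.
  Their vanishing for m < j is orthogonality to lower degrees.\<close>

lemma lint_monom_lag: "lint (monom 1 m * lag j) = (- 1) ^ j * real (m choose j) * Gamma (\<alpha> + 1 +
    real m)"
proof (induction j)
  case 0
  then show ?case by (simp add: lint_monom)
next
  case (Suc j)

  let ?p = "monom 1 m * lag j"
  have "[:0, 1:] * pderiv ?p = [:0, 1:] * monom 1 m * pderiv (lag j) + smult (real m) ?p"
  proof -
    have "[:0, 1:] * pderiv ?p = [:0, 1:] * monom 1 m * pderiv (lag j) + [:0, 1:] * pderiv (monom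
        1 m) * lag j"
      by (simp only: pderiv_mult ring_distribs mult_ac)
    then show ?thesis by (simp only: X_mult_pderiv_monom mult_smult_left)
  qed
  \<comment> \<open>The bracket integrates to 0 by \<open>lint_by_parts\<close>; only the multiple
    \<open>real j - real m\<close> of \<open>?p\<close> survives.\<close>
  then have "monom 1 m * smult (real j + 1) (lag (Suc j)) =
      ([:0, 1:] * pderiv ?p + smult (\<alpha> + 1) ?p - [:0, 1:] * ?p) + smult (real j - real m) ?p"
    unfolding lag_Suc by (simp add: algebra_simps smult_add_left smult_diff_left)
  then have "(real j + 1) * lint (monom 1 m * lag (Suc j)) = (real j - real m) * lint ?p"
    by (simp only: mult_smult_right lint_smult lint_add lint_by_parts add_0 flip: lint_smult[of
        "real j + 1"])
  also have "\<dots> = - ((- 1) ^ j * Gamma (\<alpha> + 1 + real m)) * ((real m - real j) * real (m choose j))"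
    unfolding Suc by (simp add: algebra_simps)
  also have "(real m - real j) * real (m choose j) = (real j + 1) * real (m choose Suc j)"
  proof (cases "j \<le> m")
    case True
    have "Suc j * (m choose Suc j) = (m - j) * (m choose j)"
      by (metis binomial_absorb_comp binomial_absorption)
    then show ?thesis using True by (metis of_nat_diff of_nat_mult of_nat_Suc add.commute)
  qed (simp add: binomial_eq_0)
  finally have "(real j + 1) * lint (monom 1 m * lag (Suc j)) =
      (real j + 1) * ((- 1) ^ Suc j * real (m choose Suc j) * Gamma (\<alpha> + 1 + real m))"
    by simp
  then show ?case by (subst (asm) mult_cancel_left) auto
qed

lemma degree_lag: "degree (lag j) \<le> j"
proof (induction j)
  case (Suc j)
  have "degree ([:0, 1:] * (pderiv (lag j) - lag j)) \<le> 1 + j"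
    by (rule order.trans[OF degree_mult_le])
      (use Suc in \<open>auto intro!: degree_diff_le simp: degree_pderiv\<close>)
  moreover have "degree (smult (real j + 1 + \<alpha>) (lag j)) \<le> Suc j"
    using Suc by (intro order.trans[OF degree_smult_le] le_SucI)
  ultimately show ?case
    unfolding lag.simps by (intro order.trans[OF degree_smult_le degree_add_le]) auto
qed simp

lemma coeff_lag: "coeff (lag j) j = (- 1) ^ j / fact j"
proof (induction j)
  case (Suc j)
  have "coeff (lag j) (Suc j) = 0" "coeff (pderiv (lag j)) j = 0"
    using degree_lag[of j] by (auto intro!: coeff_eq_0 simp: coeff_pderiv)
  then have "coeff (lag (Suc j)) (Suc j) = - coeff (lag j) j / (real j + 1)"
    by (simp add: lag.simps)
  then show ?case by (simp add: Suc mult.commute)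
qed simp

text \<open>Lower monomials are orthogonal to \<open>lag j\<close>, so one coefficient of p decides
  the integral. For p a Laguerre polynomial, the degree bound and the top coefficient
  suffice.\<close>

lemma lint_mult_lag:
  assumes "degree p \<le> j"
  shows "lint (p * lag j) = coeff p j * (- 1) ^ j * Gamma (\<alpha> + 1 + real j)"
proof -
  have "p * lag j = (\<Sum>i\<le>j. smult (coeff p i) (monom 1 i * lag j))"
    using poly_as_sum_of_monoms'[OF assms]
    by (metis (mono_tags, lifting) smult_monom mult_smult_left mult.right_neutral sum.cong
        sum_distrib_right)
  then have "lint (p * lag j) = (\<Sum>i\<le>j. coeff p i * lint (monom 1 i * lag j))"
    by (simp add: lint_sum lint_smult)
  also have "\<dots> = (\<Sum>i\<le>j. if i = j then coeff p j * (- 1) ^ j * Gamma (\<alpha> + 1 + real j) else 0)"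
    by (intro sum.cong) (auto simp: lint_monom_lag)
  finally show ?thesis by simp
qed

text \<open>The squared norm of \<open>lag j\<close>, see \<open>lint_lag_lag\<close>. The
  recurrences below use only its positivity and the ratio in \<open>h_Suc\<close>.\<close>

definition h :: "nat \<Rightarrow> real" where
  "h j = Gamma (\<alpha> + 1 + real j) / fact j"

lemma h_pos: "h j > 0"
  using \<alpha> by (auto simp: h_def intro!: Gamma_real_pos divide_pos_pos)

lemma h_nonneg [simp]: "h j \<ge> 0"
  using h_pos less_imp_le by blast

lemma h_Suc: "(real j + 1) * h (Suc j) = (real j + 1 + \<alpha>) * h j"
proof -
  have "Gamma (\<alpha> + 1 + real j + 1) = (\<alpha> + 1 + real j) * Gamma (\<alpha> + 1 + real j)"
    using \<alpha> by (intro Gamma_plus1) (auto elim!: nonpos_Ints_cases)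
  then have "h (Suc j) = (\<alpha> + 1 + real j) * Gamma (\<alpha> + 1 + real j) / ((real j + 1) * fact j)"
    by (simp add: h_def add_ac)
  then show ?thesis by (simp add: h_def add_ac)
qed

lemma lint_lag_lag: "lint (lag i * lag j) = (if i = j then h j else 0)"
proof -
  have less: "lint (lag i * lag j) = 0" if "i < j" for i j
    using that degree_lag[of i] by (subst lint_mult_lag) (auto intro!: coeff_eq_0)
  consider "i < j" | "j < i" | "i = j" by linarith
  then show ?thesis
  proof cases
    case 3
    then show ?thesis
      using lint_mult_lag[OF degree_lag, of j] by (simp add: coeff_lag h_def flip: power_add)
  next
    case 2
    then show ?thesis using less[of j i] by (simp add: mult.commute)
  qed (simp add: less)
qed

section \<open>Norms in coordinates of the Laguerre basis\<close>

lemma lag_expansion: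
  assumes "degree p \<le> n"
  shows "\<exists>c. p = (\<Sum>j\<le>n. smult (c j) (lag j))"
  using assms
proof (induction n arbitrary: p)
  case 0
  then show ?case
    by (auto intro!: exI[of _ "\<lambda>_. coeff p 0"] simp: degree_0_id)
next
  case (Suc n)
  define d where "d = coeff p (Suc n) / coeff (lag (Suc n)) (Suc n)"
  define q where "q = p - smult d (lag (Suc n))"
  have "coeff q (Suc n) = 0"
    by (simp add: q_def d_def coeff_lag)
  moreover have "degree q \<le> Suc n"
    unfolding q_def using Suc.prems degree_lag[of "Suc n"]
    by (intro degree_diff_le order.trans[OF degree_smult_le])
  ultimately have "degree q \<le> n"
    by (metis eq_zero_or_degree_less le_less_Suc_eq less_Suc_eq_le nat_less_le degree_0 zero_le)
  from Suc.IH[OF this] obtain c where "q = (\<Sum>j\<le>n. smult (c j) (lag j))" by blast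
  then have "p = (\<Sum>j\<le>Suc n. smult ((c(Suc n := d)) j) (lag j))"
    by (simp add: q_def algebra_simps)
  then show ?case by blast
qed

lemma lint_square_expansion:
  "lint ((\<Sum>j\<in>A. smult (c j) (lag j)) * (\<Sum>j\<in>A. smult (c j) (lag j))) = (\<Sum>j\<in>A. h j * (c j)\<^sup>2)"
  if "finite A"
proof -
  have "lint ((\<Sum>j\<in>A. smult (c j) (lag j)) * (\<Sum>j\<in>A. smult (c j) (lag j)))
      = (\<Sum>i\<in>A. \<Sum>j\<in>A. c i * c j * lint (lag i * lag j))"
    by (simp add: sum_product lint_sum lint_smult mult_ac)
  also have "\<dots> = (\<Sum>i\<in>A. \<Sum>j\<in>A. if i = j then c j * c j * h j else 0)"
    by (intro sum.cong) (auto simp: lint_lag_lag)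
  also have "\<dots> = (\<Sum>j\<in>A. h j * (c j)\<^sup>2)"
    using that by (simp add: power2_eq_square mult_ac)
  finally show ?thesis .
qed

text \<open>The two claims need each other: the Laguerre equation at j + 1 comes from the equation
  and the derivative rule at j, and it in turn removes the second derivative from the differentiated
  raising relation, which gives the next derivative rule.\<close>

lemma laguerre_ode_and_pderiv_lag_Suc:
  "[:0, 1:] * pderiv (pderiv (lag j)) + [:\<alpha> + 1, -1:] * pderiv (lag j) + smult (real j) (lag j) =
      0 \<and>
   pderiv (lag (Suc j)) = pderiv (lag j) - lag j"
proof (induction j)
  case 0
  have "lag (Suc 0) = [:1 + \<alpha>, -1:]" by (simp add: lag.simps)
  then show ?case by (simp add: pderiv_pCons one_pCons)
next
  case (Suc j)
  let ?L = "lag j"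
  have deriv: "pderiv (lag (Suc j)) = pderiv ?L - ?L" using Suc.IH by simp
  have lagS: "smult (real (Suc j)) (lag (Suc j)) =
     smult (real j + 1 + \<alpha>) ?L + [:0, 1:] * (pderiv ?L - ?L)"
    using lag_Suc[of j] by (simp add: add.commute)
  have ode: "[:0, 1:] * pderiv (pderiv (lag (Suc j))) + [:\<alpha> + 1, -1:] * pderiv (lag (Suc j))
      + smult (real (Suc j)) (lag (Suc j)) = 0" (is "?ode = 0")
  proof (rule poly_ext)
    fix x
    have "poly ([:0, 1:] * pderiv (pderiv ?L) + [:\<alpha> + 1, -1:] * pderiv ?L + smult (real j) ?L) x =
        0"
      using Suc.IH by simp
    then show "poly ?ode x = poly 0 x"
      unfolding lagS deriv pderiv_diff by (simp add: algebra_simps)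
  qed
  have "smult (real (Suc j) + 1) (pderiv (lag (Suc (Suc j)))) =
      smult (real (Suc j) + 1) (pderiv (lag (Suc j)) - lag (Suc j))"
  proof (rule poly_ext)
    fix x
    have "poly (pderiv (smult (real (Suc j) + 1) (lag (Suc (Suc j))))) x =
        poly (pderiv (smult (real (Suc j) + 1 + \<alpha>) (lag (Suc j))
          + [:0, 1:] * (pderiv (lag (Suc j)) - lag (Suc j)))) x"
      by (simp only: lag_Suc)
    moreover have "poly ?ode x = 0" using ode by simp
    ultimately show "poly (smult (real (Suc j) + 1) (pderiv (lag (Suc (Suc j))))) x =
        poly (smult (real (Suc j) + 1) (pderiv (lag (Suc j)) - lag (Suc j))) x"
      by (simp add: pderiv_add pderiv_smult pderiv_mult pderiv_diff pderiv_pCons algebra_simps)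
  qed
  then show ?case using ode by (metis smult_cancel of_nat_0_le_iff add_nonneg_eq_0_iff zero_le_one
      zero_neq_one)
qed

lemma smult_sum': "smult c (sum f A) = (\<Sum>i\<in>A. smult c (f i))"
  by (induction A rule: infinite_finite_induct) (auto simp: smult_add_right)

lemma pderiv_lag: "pderiv (lag j) = - (\<Sum>i<j. lag i)"
  by (induction j) (use laguerre_ode_and_pderiv_lag_Suc in auto)

lemma laguerre_norm_poly: "laguerre_norm \<alpha> (poly p) = sqrt (lint (p * p))"
  by (simp add: laguerre_norm_def lint_def power2_eq_square)

lemma laguerre_norm_expansion:
  "laguerre_norm \<alpha> (poly (\<Sum>j\<le>n. smult (c j) (lag j))) = sqrt (\<Sum>j\<le>n. h j * (c j)\<^sup>2)"
  by (simp add: laguerre_norm_poly lint_square_expansion)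

lemma laguerre_norm_pderiv_expansion:
  "laguerre_norm \<alpha> (poly (pderiv (\<Sum>j\<le>n. smult (c j) (lag j)))) =
     sqrt (\<Sum>i<n. h i * (\<Sum>j=Suc i..n. c j)\<^sup>2)"
proof -
  have "pderiv (\<Sum>j\<le>n. smult (c j) (lag j)) = (\<Sum>j\<le>n. \<Sum>i<j. smult (- c j) (lag i))"
    using higher_pderiv_sum[of 1 "\<lambda>j. smult (c j) (lag j)" "{..n}"]
    by (simp add: pderiv_smult pderiv_lag smult_sum' sum_negf)
  also have "\<dots> = (\<Sum>i<n. \<Sum>j=Suc i..n. smult (- c j) (lag i))"
    by (simp add: sum.Sigma) (rule sum.reindex_bij_witness[of _ "\<lambda>(i, j). (j, i)" "\<lambda>(i, j). (j,
        i)"]; auto)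
  also have "\<dots> = (\<Sum>i<n. smult (- (\<Sum>j=Suc i..n. c j)) (lag i))"
    by (simp add: smult_sum sum_negf)
  finally show ?thesis
    by (simp only: laguerre_norm_poly lint_square_expansion[OF finite_lessThan]) simp
qed

end


section \<open>Real-rooted polynomials and power sums\<close>

lemma poly_map_poly_of_real:
  "poly (map_poly of_real (p + q)) z = poly (map_poly of_real p) z + poly (map_poly of_real q) (z
      :: complex)"
  "poly (map_poly of_real (smult c p)) z = of_real c * poly (map_poly of_real p) z"
  "poly (map_poly of_real (p * q)) z = poly (map_poly of_real p) z * poly (map_poly of_real q) z"
proof -
  have add: "map_poly complex_of_real (p + q) = map_poly of_real p + map_poly of_real q" for p q
    by (rule poly_eqI) (simp add: coeff_map_poly)
  have smult: "map_poly complex_of_real (smult c p) = smult (of_real c) (map_poly of_real p)" for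
      c p
    by (rule poly_eqI) (simp add: coeff_map_poly)
  have "map_poly complex_of_real (p * q) = map_poly of_real p * map_poly of_real q"
    by (rule poly_eqI) (simp add: coeff_map_poly coeff_mult)
  then show "poly (map_poly of_real (p * q)) z = poly (map_poly of_real p) z * poly (map_poly
      of_real q) z"
    "poly (map_poly of_real (p + q)) z = poly (map_poly of_real p) z + poly (map_poly of_real q)
        (z :: complex)"
    "poly (map_poly of_real (smult c p)) z = of_real c * poly (map_poly of_real p) z"
    by (simp_all add: add smult)
qed

lemma poly_map_poly_of_real_of_real:
  "poly (map_poly of_real p) (complex_of_real x) = of_real (poly p x)"
  by (induction p) (auto simp: map_poly_pCons)

text \<open>The fundamental theorem of algebra supplies a complex root, and the hypothesis forces it
  to be real and negative. Value 1 at 0 fixes the scaling of the linear factors, and the quotient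
  inherits both hypotheses.\<close>

lemma negative_real_rooted_factorization:
  fixes p :: "real poly"
  assumes "poly p 0 = 1"
    and "\<And>z. poly (map_poly complex_of_real p) z = 0 \<Longrightarrow> \<exists>l>0. z = - of_real (1 / l)"
  shows "\<exists>ls. (\<forall>l\<in>set ls. l > 0) \<and> p = (\<Prod>l\<leftarrow>ls. [:1, l:])"
  using assms
proof (induction "degree p" arbitrary: p)
  case 0
  then have "p = [:coeff p 0:]" by (simp add: degree_0_id)
  also have "coeff p 0 = 1" using 0(2) by (simp add: poly_0_coeff_0)
  finally show ?case by (intro exI[of _ "[]"]) (simp add: one_pCons)
next
  case (Suc m)
  have "degree (map_poly complex_of_real p) > 0"
    using Suc.hyps(2) by (simp add: degree_map_poly)
  then obtain z where "poly (map_poly complex_of_real p) z = 0"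
    using alg_closed_imp_poly_has_root[of "map_poly complex_of_real p"] by auto
  with Suc.prems(2)[OF this] obtain l where l: "l > 0"
      and "poly (map_poly complex_of_real p) (- of_real (1 / l)) = 0"
    by auto
  then have "poly (map_poly complex_of_real p) (of_real (- 1 / l)) = 0"
    by simp
  then have "poly p (- 1 / l) = 0"
    by (simp only: poly_map_poly_of_real_of_real of_real_eq_0_iff)
  then obtain r where "p = [:1 / l, 1:] * r"
    unfolding poly_eq_0_iff_dvd by (auto elim: dvdE)
  \<comment> \<open>Moving the scalar 1/l to the quotient makes both factors take the value 1 at
    0.\<close>
  then have p: "p = [:1, l:] * smult (1 / l) r"
    using l by (simp add: smult_add_right)
  let ?q = "smult (1 / l) r"
  have "?q \<noteq> 0" using p Suc.hyps(2) by (metis degree_0 mult_zero_right nat.distinct(1))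
  then have "degree p = degree [:1, l:] + degree ?q"
    using l unfolding p by (intro degree_mult_eq) auto
  then have "m = degree ?q" using l Suc.hyps(2) by simp
  moreover have "poly ?q 0 = 1" using Suc.prems(1) p by simp
  moreover have "\<exists>l>0. z = - of_real (1 / l)" if "poly (map_poly complex_of_real ?q) z = 0" for z
  proof (rule Suc.prems(2))
    show "poly (map_poly complex_of_real p) z = 0"
      unfolding p poly_map_poly_of_real(3) that by simp
  qed
  ultimately obtain ls where "\<forall>l\<in>set ls. l > 0" "?q = (\<Prod>l\<leftarrow>ls. [:1, l:])"
    using Suc.hyps(1)[of ?q] by blast
  then show ?case using p l by (intro exI[of _ "l # ls"]) simp
qed

section \<open>Power sums and Newton's identities\<close>

definition power_sum :: "real list \<Rightarrow> nat \<Rightarrow> real" where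
  "power_sum ls k = (\<Sum>l\<leftarrow>ls. l ^ k)"

lemma coeff_linear_mult_0: "coeff ([:1, l:] * q) 0 = coeff q 0"
  and coeff_linear_mult_Suc: "coeff ([:1, l:] * q) (Suc k) = coeff q (Suc k) + l * coeff (q ::
      real poly) k"
  by (auto simp: coeff_pCons)

text \<open>Adjoining l multiplies the generating polynomial by 1 + l X and adds powers of l to the
  power sums. The sum on the right splits accordingly into a part with the old power sums
  (\<open>main\<close>) and a part with the powers of l (\<open>tele\<close>).\<close>

lemma newton_identity:
  "(real k + 1) * coeff (\<Prod>l\<leftarrow>ls. [:1, l:]) (Suc k) =
    (\<Sum>i\<le>k. (- 1) ^ i * coeff (\<Prod>l\<leftarrow>ls. [:1, l:]) (k - i) * power_sum ls (Suc i))"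
proof (induction ls arbitrary: k)
  case Nil
  then show ?case by (simp add: power_sum_def)
next
  case (Cons l ls)
  define q where "q = (\<Prod>l\<leftarrow>ls. [:1, l:])"
  define q' where "q' = [:1, l:] * q"
  have IH: "(real k + 1) * coeff q (Suc k) = (\<Sum>i\<le>k. (- 1) ^ i * coeff q (k - i) * power_sum ls
      (Suc i))" for k
    using Cons.IH by (simp add: q_def)
  \<comment> \<open>Coefficient form of (l / (1 + l X)) \<open>q'\<close> = l \<open>q\<close>, with
    the fraction expanded as a geometric series.\<close>
  have tele: "(\<Sum>i\<le>k. (- 1) ^ i * coeff q' (k - i) * l ^ Suc i) = l * coeff q k" for k
  proof (induction k)
    case 0
    then show ?case by (simp add: q'_def coeff_linear_mult_0 del: mult_pCons_left)
  next
    case (Suc k)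
    have "(\<Sum>i\<le>Suc k. (- 1) ^ i * coeff q' (Suc k - i) * l ^ Suc i) =
        coeff q' (Suc k) * l - l * (\<Sum>i\<le>k. (- 1) ^ i * coeff q' (k - i) * l ^ Suc i)"
      by (subst sum.atMost_Suc_shift) (simp add: sum_distrib_left sum_negf[symmetric] mult_ac)
    then show ?case
      unfolding Suc by (simp add: q'_def coeff_linear_mult_Suc algebra_simps del: mult_pCons_left)
  qed
  \<comment> \<open>Since the k-th coefficient of \<open>q'\<close> is that of \<open>q\<close> plus
    l times the previous one, the induction hypothesis enters at index k and, with weight l, at
    index k - 1.\<close>
  have main: "(\<Sum>i\<le>k. (- 1) ^ i * coeff q' (k - i) * power_sum ls (Suc i)) =
      (real k + 1) * coeff q (Suc k) + l * real k * coeff q k"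
  proof (cases k)
    case 0
    then show ?thesis using IH[of 0] by (simp add: q'_def coeff_linear_mult_0 del: mult_pCons_left)
  next
    case (Suc m)
    have "(\<Sum>i\<le>m. (- 1) ^ i * coeff q' (Suc m - i) * power_sum ls (Suc i)) =
      (\<Sum>i\<le>m. (- 1) ^ i * coeff q (Suc m - i) * power_sum ls (Suc i)) +
      l * (\<Sum>i\<le>m. (- 1) ^ i * coeff q (m - i) * power_sum ls (Suc i))"
      by (simp add: sum_distrib_left flip: sum.distrib)
        (intro sum.cong, auto simp: Suc_diff_le q'_def coeff_linear_mult_Suc algebra_simps simp
            del: mult_pCons_left)
    moreover have "coeff q' 0 = coeff q 0"
      by (simp add: q'_def coeff_linear_mult_0 del: mult_pCons_left)
    ultimately show ?thesis
      using IH[of m, symmetric] IH[of "Suc m", symmetric] by (simp add: Suc algebra_simps)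
  qed
  have "(real k + 1) * coeff q' (Suc k) =
      (\<Sum>i\<le>k. (- 1) ^ i * coeff q' (k - i) * power_sum ls (Suc i)) +
      (\<Sum>i\<le>k. (- 1) ^ i * coeff q' (k - i) * l ^ Suc i)"
    unfolding main tele by (simp add: q'_def coeff_linear_mult_Suc algebra_simps del:
        mult_pCons_left)
  then show ?case
    by (simp add: power_sum_def q_def q'_def distrib_left sum.distrib add.commute del:
        mult_pCons_left)
qed

section \<open>The discrete Hardy inequality\<close>

context laguerre
begin

text \<open>The eigenvalue equation with eigenvalue parameter \<open>- X\<close>: \<^term>\<open>chi j\<close> is the solution
  started at \<open>1\<close> and \<^term>\<open>dchi j\<close> its backward difference. The sign makes all coefficients nonnegative.\<close>

fun chi dchi :: "nat \<Rightarrow> real poly" where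
  "chi 0 = 1"
| "chi (Suc j) = chi j + smult ((real j + 1) / (real j + 1 + \<alpha>)) (dchi j + [:0, 1:] * chi j)"
| "dchi 0 = 0"
| "dchi (Suc j) = smult ((real j + 1) / (real j + 1 + \<alpha>)) (dchi j + [:0, 1:] * chi j)"

lemma chi_Suc: "chi (Suc j) = chi j + dchi (Suc j)"
  by simp

text \<open>The recurrence in self-adjoint form: the weighted difference \<open>h j * dchi j\<close>
  increases by X \<open>h j\<close> \<open>chi j\<close>. This form makes summation by parts
  work.\<close>

lemma h_dchi_Suc: "smult (h (Suc j)) (dchi (Suc j)) = smult (h j) (dchi j + [:0, 1:] * chi j)"
proof -
  have "h (Suc j) * ((real j + 1) / (real j + 1 + \<alpha>)) = h j"
    using h_Suc[of j] \<alpha> by (simp add: field_simps)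
  then show ?thesis by simp
qed

declare chi.simps(2) [simp del] dchi.simps(2) [simp del]

text \<open>Green's formula: the recurrence is multiplied by the conjugate of the solution and
  summed by parts. The start contributes nothing because \<open>dchi 0 = 0\<close>, and the boundary
  term on the right vanishes at a root of \<open>chi n\<close>.\<close>

lemma chi_green_complex:
  fixes z :: complex
  defines "u \<equiv> \<lambda>j. poly (map_poly of_real (chi j)) z" and "d \<equiv> \<lambda>j. poly (map_poly of_real (dchi
      j)) z"
  shows "(\<Sum>j<n. of_real (h (Suc j)) * (d (Suc j) * cnj (d (Suc j))))
           + z * (\<Sum>j<n. of_real (h j) * (u j * cnj (u j))) = of_real (h n) * d n * cnj (u n)"
proof (induction n)
  case 0
  then show ?case by (simp add: d_def)
next
  case (Suc n)
  have u: "u (Suc n) = u n + d (Suc n)"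
    unfolding u_def d_def chi_Suc poly_map_poly_of_real ..
  have "of_real (h (Suc n)) * d (Suc n) = of_real (h n) * (d n + z * u n)"
    using arg_cong[OF h_dchi_Suc[of n], of "\<lambda>p. poly (map_poly complex_of_real p) z"]
    by (simp only: poly_map_poly_of_real u_def d_def) (simp add: map_poly_pCons)
  then have "of_real (h (Suc n)) * d (Suc n) * cnj (u n) = of_real (h n) * (d n + z * u n) * cnj
      (u n)"
    by simp
  moreover have "cnj (u (Suc n)) = cnj (u n) + cnj (d (Suc n))" by (simp add: u)
  ultimately show ?case using Suc by (simp add: algebra_simps)
qed

lemma chi_0: "poly (chi n) 0 = 1"
proof -
  have "poly (dchi n) 0 = 0 \<and> poly (chi n) 0 = 1"
    by (induction n) (auto simp: chi.simps dchi.simps)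
  then show ?thesis by simp
qed

lemma chi_green:
  "(\<Sum>j<n. h (Suc j) * (poly (dchi (Suc j)) x)\<^sup>2) + x * (\<Sum>j<n. h j * (poly (chi j) x)\<^sup>2)
     = h n * poly (dchi n) x * poly (chi n) x"
proof -
  have "complex_of_real ((\<Sum>j<n. h (Suc j) * (poly (dchi (Suc j)) x)\<^sup>2)
      + x * (\<Sum>j<n. h j * (poly (chi j) x)\<^sup>2)) = of_real (h n * poly (dchi n) x * poly (chi n) x)"
    using chi_green_complex[where z = "of_real x" and n = n]
    by (simp add: poly_map_poly_of_real_of_real power2_eq_square)
  then show ?thesis by (simp only: of_real_eq_iff)
qed

text \<open>At a root, Green's formula reads A + z B = 0 with real A \<ge> 0 and B > 0, the latter
  because \<open>chi 0 = 1\<close>. So z is real and at most 0, and z = 0 is excluded by the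
  constant term 1 of \<open>chi n\<close>. Hence l = B / A.\<close>

lemma chi_roots:
  assumes "poly (map_poly complex_of_real (chi n)) z = 0"
  shows "\<exists>l>0. z = - of_real (1 / l)"
proof -
  define u where "u j = poly (map_poly complex_of_real (chi j)) z" for j
  define d where "d j = poly (map_poly complex_of_real (dchi j)) z" for j
  define A where "A = (\<Sum>j<n. h (Suc j) * (cmod (d (Suc j)))\<^sup>2)"
  define B where "B = (\<Sum>j<n. h j * (cmod (u j))\<^sup>2)"
  have un: "u n = 0" using assms by (simp add: u_def)
  have u0: "u 0 = 1" by (simp add: u_def map_poly_1)
  have "n > 0" using un u0 by (cases n) auto
  have "h 0 * (cmod (u 0))\<^sup>2 \<le> B"
    unfolding B_def using \<open>n > 0\<close> by (intro member_le_sum) auto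
  then have "B > 0" using u0 h_pos[of 0] by simp
  have AB: "of_real A + z * of_real B = 0"
    using chi_green_complex[where n = n and z = z] un
    by (simp add: A_def B_def u_def d_def complex_norm_square[symmetric])
  then have z: "z = - of_real (A / B)"
    using \<open>B > 0\<close> by (simp add: field_simps add_eq_0_iff)
  have "A \<ge> 0" unfolding A_def by (intro sum_nonneg mult_nonneg_nonneg) auto
  moreover have "A \<noteq> 0"
  proof
    assume "A = 0"
    then have "z = 0" using z by simp
    then show False using assms chi_0[of n] poly_map_poly_of_real_of_real[of "chi n" 0] by simp
  qed
  ultimately have "A > 0" by simp
  then show ?thesis using z \<open>B > 0\<close> by (intro exI[of _ "B / A"]) auto
qed

text \<open>The negated reciprocals of the roots of \<open>chi n\<close>. They form a list, since
  the power sums count multiplicities; simplicity of the roots is then never at issue.\<close>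

definition evs :: "nat \<Rightarrow> real list" where
  "evs n = (SOME ls. (\<forall>l\<in>set ls. l > 0) \<and> chi n = (\<Prod>l\<leftarrow>ls. [:1, l:]))"

lemma evs: "\<forall>l\<in>set (evs n). l > 0" "chi n = (\<Prod>l\<leftarrow>evs n. [:1, l:])"
proof -
  have "\<exists>ls. (\<forall>l\<in>set ls. l > 0) \<and> chi n = (\<Prod>l\<leftarrow>ls. [:1, l:])"
    using chi_0 chi_roots by (rule negative_real_rooted_factorization)
  then have "(\<forall>l\<in>set (evs n). l > 0) \<and> chi n = (\<Prod>l\<leftarrow>evs n. [:1, l:])"
    unfolding evs_def by (rule someI_ex)
  then show "\<forall>l\<in>set (evs n). l > 0" "chi n = (\<Prod>l\<leftarrow>evs n. [:1, l:])" by auto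
qed

lemma chi_root_evs:
  assumes "l \<in> set (evs n)"
  shows "poly (chi n) (- 1 / l) = 0"
proof -
  have "l > 0" using assms evs(1) by blast
  then have "poly [:1, l:] (- 1 / l) = 0" by simp
  moreover have "[:1, l:] dvd chi n"
    unfolding evs(2) using assms by (intro prod_list_dvd) auto
  ultimately show ?thesis by (metis dvdE mult_zero_left poly_mult)
qed

lemma chi_pos:
  assumes "\<And>l. l \<in> set (evs j) \<Longrightarrow> \<mu> * l < 1"
  shows "poly (chi j) (- \<mu>) > 0"
proof -
  have "poly (\<Prod>l\<leftarrow>ls. [:1, l:]) (- \<mu>) > 0" if "\<And>l. l \<in> set ls \<Longrightarrow> \<mu> * l < 1" for ls
    using that by (induction ls) auto
  then show ?thesis using assms evs(2)[of j] by simp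
qed

text \<open>A discrete Picone identity with the positive ground state \<^term>\<open>\<lambda>j. poly (chi j) (- \<mu>)\<close>.\<close>

lemma discrete_hardy:
  assumes pos: "\<And>j. j \<le> n \<Longrightarrow> poly (chi j) (- \<mu>) > 0"
  shows "h n * poly (dchi n) (- \<mu>) / poly (chi n) (- \<mu>) * (v n)\<^sup>2
     \<le> (\<Sum>j<n. h (Suc j) * (v j - v (Suc j))\<^sup>2) - \<mu> * (\<Sum>j<n. h j * (v j)\<^sup>2)"
  using pos
proof (induction n)
  case 0
  then show ?case by simp
next
  case (Suc n)
  define u where "u j = poly (chi j) (- \<mu>)" for j
  define d where "d j = poly (dchi j) (- \<mu>)" for j
  define H where "H = h (Suc n)"
  have up: "u n > 0" "u (Suc n) > 0" using Suc.prems by (auto simp: u_def)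
  have rec: "u (Suc n) = u n + d (Suc n)" by (simp add: u_def d_def chi_Suc)
  have "H * d (Suc n) = h n * (d n - \<mu> * u n)"
    using arg_cong[OF h_dchi_Suc[of n], of "\<lambda>p. poly p (- \<mu>)"] by (simp add: H_def u_def d_def)
  \<comment> \<open>The recurrence moves the boundary term of the induction hypothesis up one index
    and produces the summand \<mu> \<open>h n\<close> of the Hardy sum.\<close>
  then have hd: "h n * d n / u n = H * d (Suc n) / u n + \<mu> * h n"
    using up by (simp add: field_simps)
  \<comment> \<open>Completing the square: the left side vanishes exactly when v is proportional to
    the ground state u at the two neighbouring indices. Dividing by \<open>u n * u (Suc n)\<close>
    is where positivity enters.\<close>
  have "H * ((u (Suc n) * v n - u n * v (Suc n))\<^sup>2 / (u n * u (Suc n))) =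
      H * (d (Suc n) / u n * (v n)\<^sup>2 + (v n - v (Suc n))\<^sup>2 - d (Suc n) / u (Suc n) * (v (Suc n))\<^sup>2)"
    using up unfolding rec by (simp add: field_simps power2_eq_square)
  moreover have "H * ((u (Suc n) * v n - u n * v (Suc n))\<^sup>2 / (u n * u (Suc n))) \<ge> 0"
    using up h_pos[of "Suc n"] by (simp add: H_def)
  ultimately have "H * d (Suc n) / u (Suc n) * (v (Suc n))\<^sup>2
      \<le> H * d (Suc n) / u n * (v n)\<^sup>2 + H * (v n - v (Suc n))\<^sup>2"
    by (simp add: algebra_simps)
  also have "\<dots> = h n * d n / u n * (v n)\<^sup>2 + H * (v n - v (Suc n))\<^sup>2 - \<mu> * (h n * (v n)\<^sup>2)"
    unfolding hd by (simp add: algebra_simps)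
  also have "\<dots> \<le> (\<Sum>j<Suc n. h (Suc j) * (v j - v (Suc j))\<^sup>2) - \<mu> * (\<Sum>j<Suc n. h j * (v j)\<^sup>2)"
    using Suc.IH Suc.prems by (simp add: u_def d_def H_def algebra_simps)
  finally show ?case by (simp add: u_def d_def H_def)
qed

section \<open>From eigenvalues to the Markov constant\<close>

lemma laguerre_norm_pos:
  assumes "p \<noteq> 0"
  shows "laguerre_norm \<alpha> (poly p) > 0"
proof -
  obtain c where c: "p = (\<Sum>j\<le>degree p. smult (c j) (lag j))"
    using lag_expansion by blast
  have "(\<Sum>j\<le>degree p. h j * (c j)\<^sup>2) > 0"
  proof (rule ccontr)
    assume "\<not> ?thesis"
    moreover have "(\<Sum>j\<le>degree p. h j * (c j)\<^sup>2) \<ge> 0"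
      by (intro sum_nonneg mult_nonneg_nonneg) auto
    ultimately have "(\<Sum>j\<le>degree p. h j * (c j)\<^sup>2) = 0" by simp
    then have "\<forall>j\<in>{..degree p}. h j * (c j)\<^sup>2 = 0"
      by (subst (asm) sum_nonneg_eq_0_iff) auto
    then have "\<forall>j\<le>degree p. c j = 0" using h_pos by (auto simp: less_le)
    then show False using c assms by simp
  qed
  then show ?thesis by (subst c, subst laguerre_norm_expansion) simp
qed

text \<open>For \<mu> < 1/C every factor 1 - \<mu> l of \<open>chi j\<close> at -\<mu> is positive,
  so \<open>discrete_hardy\<close> applies with this ground state. The value 1/C itself may be a
  critical parameter and is reached only as a limit.\<close>

lemma markov_const_le:
  assumes "C > 0" and bound: "\<And>j l. j \<le> n \<Longrightarrow> l \<in> set (evs j) \<Longrightarrow> l \<le> C"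
  shows "markov_const n \<alpha> \<le> ereal (sqrt C)"
  unfolding markov_const_def
proof (rule SUP_least)
  fix p :: "real poly"
  assume "p \<in> {p. degree p \<le> n \<and> p \<noteq> 0}"
  then have "degree p \<le> n" "p \<noteq> 0" by auto
  obtain c where c: "p = (\<Sum>j\<le>n. smult (c j) (lag j))"
    using lag_expansion[OF \<open>degree p \<le> n\<close>] by blast
  define v where "v i = (\<Sum>j=Suc i..n. c j)" for i
  define A where "A = (\<Sum>i<n. h i * (v i)\<^sup>2)"
  define B where "B = (\<Sum>j\<le>n. h j * (c j)\<^sup>2)"
  have "A \<ge> 0" unfolding A_def by (intro sum_nonneg mult_nonneg_nonneg) auto
  have mu: "\<mu> * A \<le> B" if "0 < \<mu>" "\<mu> < 1 / C" for \<mu>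
  proof -
    have "\<mu> * l < 1" if "j \<le> n" "l \<in> set (evs j)" for j l
    proof -
      have "\<mu> * l \<le> \<mu> * C" using bound[OF that] \<open>0 < \<mu>\<close> by simp
      also have "\<dots> < 1" using \<open>\<mu> < 1 / C\<close> \<open>C > 0\<close> by (simp add: field_simps)
      finally show ?thesis .
    qed
    then have "poly (chi j) (- \<mu>) > 0" if "j \<le> n" for j
      using that by (intro chi_pos) auto
    \<comment> \<open>The tail sum \<open>v n\<close> is empty, so the boundary term of the Hardy
      inequality is 0.\<close>
    then have "0 \<le> (\<Sum>j<n. h (Suc j) * (v j - v (Suc j))\<^sup>2) - \<mu> * A"
      using discrete_hardy[of n \<mu> v] by (simp add: A_def v_def)
    also have "(\<Sum>j<n. h (Suc j) * (v j - v (Suc j))\<^sup>2) = (\<Sum>j<n. h (Suc j) * (c (Suc j))\<^sup>2)"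
      by (intro sum.cong) (auto simp: v_def sum.atLeast_Suc_atMost)
    \<comment> \<open>What is dropped is \<open>h 0 * (c 0)^2\<close>, the share of the constant
      component, which differentiation kills.\<close>
    also have "\<dots> \<le> B"
      unfolding B_def by (subst sum.atMost_shift) (use h_pos[of 0] in simp)
    finally show ?thesis by simp
  qed
  \<comment> \<open>Passage to the limit: if the claim failed, some \<mu> strictly between B / A and
    1 / C would contradict \<open>mu\<close>.\<close>
  have "A \<le> C * B"
  proof (rule ccontr)
    assume *: "\<not> A \<le> C * B"
    have "B \<ge> 0" unfolding B_def by (intro sum_nonneg mult_nonneg_nonneg) auto
    then have "A > 0" using * \<open>C > 0\<close> by (smt (verit) mult_nonneg_nonneg)
    then have "B / A < 1 / C" using * \<open>C > 0\<close> by (simp add: field_simps)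
    then obtain \<mu> where "B / A < \<mu>" "\<mu> < 1 / C" using dense by blast
    moreover have "B / A \<ge> 0" using \<open>A > 0\<close> \<open>B \<ge> 0\<close> by simp
    ultimately have "\<mu> * A \<le> B" by (intro mu) auto
    then show False using \<open>B / A < \<mu>\<close> \<open>A > 0\<close> by (simp add: field_simps)
  qed
  then have "sqrt A \<le> sqrt C * sqrt B"
    by (metis real_sqrt_le_iff real_sqrt_mult)
  moreover have "laguerre_norm \<alpha> (poly p) = sqrt B" "laguerre_norm \<alpha> (poly (pderiv p)) = sqrt A"
    unfolding c laguerre_norm_expansion laguerre_norm_pderiv_expansion by (simp_all add: A_def
        B_def v_def)
  ultimately show "ereal (laguerre_norm \<alpha> (poly (pderiv p)) / laguerre_norm \<alpha> (poly p)) \<le> ereal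
      (sqrt C)"
    using laguerre_norm_pos[OF \<open>p \<noteq> 0\<close>] by (simp add: field_simps)
qed

text \<open>The extremal polynomial has the differences \<open>dchi j\<close> at x = -1/l as
  Laguerre coefficients. Its tail sums are then minus the solution itself, and Green's formula at
  the root makes the quotient of squared norms exactly l.\<close>

lemma markov_const_ge:
  assumes "l \<in> set (evs n)"
  shows "ereal (sqrt l) \<le> markov_const n \<alpha>"
proof -
  have "l > 0" using assms evs(1) by blast
  define x where "x = - 1 / l"
  have root: "poly (chi n) x = 0" using chi_root_evs[OF assms] by (simp add: x_def)
  define u where "u j = poly (chi j) x" for j
  define d where "d j = poly (dchi j) x" for j
  define p where "p = (\<Sum>j\<le>n. smult (d j) (lag j))"
  define A where "A = (\<Sum>i<n. h i * (u i)\<^sup>2)"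
  define B where "B = (\<Sum>j\<le>n. h j * (d j)\<^sup>2)"
  have d0: "d 0 = 0" by (simp add: d_def)
  have "B = (\<Sum>j<n. h (Suc j) * (d (Suc j))\<^sup>2)"
    unfolding B_def by (subst sum.atMost_shift) (simp add: d0)
  then have "B + x * A = 0"
    using chi_green[where n = n and x = x] root by (simp add: A_def u_def d_def)
  then have AB: "A = l * B" using \<open>l > 0\<close> by (simp add: x_def field_simps)
  have "n > 0" using assms evs(1) root by (cases n) (auto)
  have "h 0 * (u 0)\<^sup>2 \<le> A"
    unfolding A_def using \<open>n > 0\<close> by (intro member_le_sum) auto
  then have "A > 0" using h_pos[of 0] by (simp add: u_def)
  then have "B > 0" using AB \<open>l > 0\<close> by (simp add: zero_less_mult_iff)
  \<comment> \<open>The differences telescope to \<open>u n - u i\<close>, and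
    \<open>u n = 0\<close> at the root.\<close>
  have tele: "(\<Sum>j=Suc i..n. d j) = - u i" if "i < n" for i
  proof -
    have "(\<Sum>j=Suc i..m. d j) = u m - u i" if "i \<le> m" for m
      using that by (induction m rule: dec_induct) (auto simp: u_def d_def chi_Suc)
    then show ?thesis using that root by (simp add: u_def)
  qed
  have norm: "laguerre_norm \<alpha> (poly p) = sqrt B"
    by (simp add: p_def laguerre_norm_expansion B_def)
  have dnorm: "laguerre_norm \<alpha> (poly (pderiv p)) = sqrt A"
    by (simp add: p_def laguerre_norm_pderiv_expansion A_def tele)
  have "p \<noteq> 0" using norm \<open>B > 0\<close> by (auto simp: laguerre_norm_poly)
  moreover have "degree p \<le> n"
    unfolding p_def using degree_lag
    by (intro degree_sum_le order.trans[OF degree_smult_le]) (auto intro: order.trans)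
  ultimately have "ereal (laguerre_norm \<alpha> (poly (pderiv p)) / laguerre_norm \<alpha> (poly p)) \<le>
      markov_const n \<alpha>"
    unfolding markov_const_def by (intro SUP_upper) auto
  also have "laguerre_norm \<alpha> (poly (pderiv p)) / laguerre_norm \<alpha> (poly p) = sqrt l"
    unfolding norm dnorm AB using \<open>B > 0\<close> by (simp add: real_sqrt_mult)
  finally show ?thesis .
qed

lemma markov_const_le_power_sum:
  assumes "C > 0" "k > 0" and bound: "\<And>j. j \<le> n \<Longrightarrow> power_sum (evs j) k \<le> C ^ k"
  shows "markov_const n \<alpha> \<le> ereal (sqrt C)"
proof (rule markov_const_le[OF \<open>C > 0\<close>])
  fix j l
  assume jl: "j \<le> n" "l \<in> set (evs j)"
  have "l ^ k \<le> power_sum (evs j) k"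
    unfolding power_sum_def using jl evs(1)[of j]
    by (intro member_le_sum_list) (auto intro: less_imp_le)
  then have "l ^ k \<le> C ^ k" using bound[OF jl(1)] by simp
  then show "l \<le> C" using \<open>C > 0\<close> \<open>k > 0\<close>
    by (cases k) (auto intro: power_le_imp_le_base)
qed

lemma markov_const_ge_power_sum:
  assumes "power_sum (evs n) k > 0" and le: "C * power_sum (evs n) k \<le> power_sum (evs n) (Suc k)"
  shows "ereal (sqrt C) \<le> markov_const n \<alpha>"
proof -
  have "evs n \<noteq> []" using assms(1) by (auto simp: power_sum_def)
  define M where "M = Max (set (evs n))"
  have M: "M \<in> set (evs n)" using \<open>evs n \<noteq> []\<close> by (simp add: M_def)
  have "power_sum (evs n) (Suc k) \<le> (\<Sum>l\<leftarrow>evs n. M * l ^ k)"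
    unfolding power_sum_def using evs(1)[of n]
    by (intro sum_list_mono) (auto simp: M_def intro!: mult_right_mono zero_le_power)
  also have "\<dots> = M * power_sum (evs n) k"
    by (simp add: power_sum_def sum_list_const_mult)
  finally have "C * power_sum (evs n) k \<le> M * power_sum (evs n) k" using le by simp
  then have "C \<le> M" using assms(1) by simp
  then have "ereal (sqrt C) \<le> ereal (sqrt M)" by simp
  also have "\<dots> \<le> markov_const n \<alpha>" by (rule markov_const_ge[OF M])
  finally show ?thesis .
qed

end

section \<open>Closed forms of the power sums\<close>

text \<open>With \<open>b = \<alpha> + 1\<close>, up to denominators depending on \<open>b\<close> only, \<open>esymk b n\<close> and \<open>desymk b n\<close> are the
  coefficients of \<open>X\<^sup>k\<close> in \<open>chi n\<close> and \<open>dchi n\<close>, and \<open>psumk b n\<close> is the power sum \<open>p\<^sub>k\<close>. They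
  come from solving the recurrence in the basis of falling factorials of \<open>n\<close>, where it is diagonal.\<close>

definition esym1 :: "real \<Rightarrow> real \<Rightarrow> real" where
  "esym1 b x = (x + 1) * x *
    (1)"

definition desym1 :: "real \<Rightarrow> real \<Rightarrow> real" where
  "desym1 b x = x *
    (2)"

text \<open>The zeros at x = 0 and x = 1, and likewise at 0, ..., k - 1 for \<open>esymk\<close>,
  reflect that \<open>chi n\<close> has no term X^k for n < k.\<close>

definition esym2 :: "real \<Rightarrow> real \<Rightarrow> real" where
  "esym2 b x = (x + 1) * x * (x - 1) *
    ((3*b + 3)*x + 2*b + 10)"

definition desym2 :: "real \<Rightarrow> real \<Rightarrow> real" where
  "desym2 b x = x * (x - 1) *
    ((12*b + 12)*x + 24)"

definition esym3 :: "real \<Rightarrow> real \<Rightarrow> real" where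
  "esym3 b x = (x + 1) * x * (x - 1) * (x - 2) *
    ((5*b^2 + 20*b + 15)*x^2 + (5*b^2 + 76*b + 119)*x + 12*b + 228)"

definition desym3 :: "real \<Rightarrow> real \<Rightarrow> real" where
  "desym3 b x = x * (x - 1) * (x - 2) *
    ((30*b^2 + 120*b + 90)*x^2 + (- 10*b^2 + 240*b + 490)*x - 120*b + 600)"

definition esym4 :: "real \<Rightarrow> real \<Rightarrow> real" where
  "esym4 b x = (x + 1) * x * (x - 1) * (x - 2) * (x - 3) *
    ((105*b^3 + 945*b^2 + 2415*b + 1575)*x^3 + (105*b^3 + 3969*b^2 + 19695*b + 21591)*x^2 + (-
    70*b^3 - 406*b^2 + 35510*b + 96006)*x - 56*b^3 - 1400*b^2 - 14984*b + 137400)"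

definition desym4 :: "real \<Rightarrow> real \<Rightarrow> real" where
  "desym4 b x = x * (x - 1) * (x - 2) * (x - 3) *
    ((840*b^3 + 7560*b^2 + 19320*b + 12600)*x^3 + (- 840*b^3 + 13608*b^2 + 101640*b + 127512)*x^2 +
    (- 25872*b^2 + 67200*b + 402192)*x + 6720*b^2 - 147840*b + 383040)"

definition esym5 :: "real \<Rightarrow> real \<Rightarrow> real" where
  "esym5 b x = (x + 1) * x * (x - 1) * (x - 2) * (x - 3) * (x - 4) *
    ((21*b^4 + 336*b^3 + 1806*b^2 + 3696*b + 2205)*x^4 + (14*b^4 + 1456*b^3 + 15460*b^2 + 50512*b +
    45454)*x^3 + (- 49*b^4 - 1288*b^3 + 22146*b^2 + 208264*b + 343471)*x^2 + (- 42*b^4 - 2024*b^3 -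
    46612*b^2 + 169128*b + 1121406)*x - 240*b^3 - 8400*b^2 - 349200*b + 1325520)"

definition desym5 :: "real \<Rightarrow> real \<Rightarrow> real" where
  "desym5 b x = x * (x - 1) * (x - 2) * (x - 3) * (x - 4) *
    ((210*b^4 + 3360*b^3 + 18060*b^2 + 36960*b + 22050)*x^4 + (- 420*b^4 + 4368*b^3 + 92184*b^2 +
    358512*b + 351756)*x^3 + (70*b^4 - 25088*b^3 - 39708*b^2 + 882560*b + 2004566)*x^2 + (28*b^4 +
    16240*b^3 - 360456*b^2 - 376432*b + 4752620)*x - 3360*b^3 + 225120*b^2 - 2133600*b + 3847200)"

definition esym6 :: "real \<Rightarrow> real \<Rightarrow> real" where
  "esym6 b x = (x + 1) * x * (x - 1) * (x - 2) * (x - 3) * (x - 4) * (x - 5) *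
    ((3465*b^5 + 86625*b^4 + 796950*b^3 + 3291750*b^2 + 5852385*b + 3274425)*x^5 + (360360*b^4 +
    7001280*b^3 + 46229040*b^2 + 118797120*b + 93724200)*x^4 + (- 17325*b^5 - 876645*b^4 +
    4733586*b^3 + 169997058*b^2 + 836360091*b + 1052171235)*x^3 + (- 12320*b^5 - 1119800*b^4 -
    50029056*b^3 - 85888528*b^2 + 2086943264*b + 5767354440)*x^2 + (7700*b^5 + 184580*b^4 -
    2476584*b^3 - 886221512*b^2 - 578212844*b + 15357765060)*x + 5280*b^5 + 322080*b^4 +
    6804864*b^3 + 228467712*b^2 - 6449042976*b + 15793475040)"

definition desym6 :: "real \<Rightarrow> real \<Rightarrow> real" where
  "desym6 b x = x * (x - 1) * (x - 2) * (x - 3) * (x - 4) * (x - 5) *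
    ((41580*b^5 + 1039500*b^4 + 9563400*b^3 + 39501000*b^2 + 70228620*b + 39293100)*x^5 + (-
    138600*b^5 + 498960*b^4 + 45136080*b^3 + 376849440*b^2 + 1072672920*b + 899989200)*x^4 +
    (69300*b^5 - 13513500*b^4 - 106916040*b^3 + 543521880*b^2 + 5209354260*b + 7939196100)*x^3 +
    (27720*b^5 + 17115120*b^4 - 321417360*b^3 - 2707737120*b^2 + 5590407240*b + 33346724400)*x^2 +
    (- 6945840*b^4 + 570176640*b^3 - 3796958880*b^2 - 18653627520*b + 65636168400)*x + 1330560*b^4
    - 228856320*b^3 + 5638913280*b^2 - 33492856320*b + 47241532800)"

definition psum1 :: "real \<Rightarrow> real \<Rightarrow> real" where
  "psum1 b x = x * (x + 1) *
    (1)"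

definition psum2 :: "real \<Rightarrow> real \<Rightarrow> real" where
  "psum2 b x = x * (x + 1) *
    ((3*b + 3)*x^2 + (2*b^2 + b + 3)*x + b^2 + 5*b)"

definition psum3 :: "real \<Rightarrow> real \<Rightarrow> real" where
  "psum3 b x = x * (x + 1) *
    ((20*b^2 + 80*b + 60)*x^4 + (24*b^3 + 76*b^2 + 100*b + 120)*x^3 + (5*b^4 + 11*b^3 + 134*b^2 +
    170*b + 60)*x^2 + (5*b^4 + 59*b^3 + 6*b^2 + 150*b)*x + 6*b^3 + 114*b^2)"

definition psum4 :: "real \<Rightarrow> real \<Rightarrow> real" where
  "psum4 b x = x * (x + 1) *
    ((525*b^5 + 6510*b^4 + 29400*b^3 + 60270*b^2 + 55755*b + 18900)*x^6 + (900*b^6 + 10095*b^5 +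
    44250*b^4 + 104880*b^3 + 155190*b^2 + 142065*b + 56700)*x^5 + (420*b^7 + 3930*b^6 + 21475*b^5 +
    87070*b^4 + 208720*b^3 + 268380*b^2 + 179865*b + 56700)*x^4 + (42*b^8 + 336*b^7 + 7452*b^6 +
    42449*b^5 + 112136*b^4 + 201620*b^3 + 256830*b^2 + 156555*b + 18900)*x^3 + (63*b^8 + 1554*b^7 +
    4308*b^6 + 26606*b^5 + 107489*b^4 + 183800*b^3 + 157500*b^2 + 63000*b)*x^2 + (7*b^8 + 406*b^7 +
    11022*b^6 + 24354*b^5 + 33561*b^4 + 88360*b^3 + 74130*b^2)*x - 7*b^8 - 196*b^7 - 2412*b^6 +
    11206*b^5 + 47779*b^4 + 34350*b^3)"

definition psum5 :: "real \<Rightarrow> real \<Rightarrow> real" where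
  "psum5 b x = x * (x + 1) *
    ((1764*b^6 + 36036*b^5 + 282744*b^4 + 1079064*b^3 + 2080260*b^2 + 1884708*b + 635040)*x^8 +
    (3920*b^7 + 74116*b^6 + 553504*b^5 + 2158856*b^4 + 4961376*b^3 + 7226100*b^2 + 6480432*b +
    2540160)*x^7 + (2835*b^8 + 47110*b^7 + 351134*b^6 + 1688666*b^5 + 5630149*b^4 + 12106584*b^3 +
    15250410*b^2 + 10779048*b + 3810240)*x^6 + (720*b^9 + 9405*b^8 + 103130*b^7 + 816406*b^6 +
    3568294*b^5 + 9378551*b^4 + 16475256*b^3 + 19810350*b^2 + 12301632*b + 2540160)*x^5 + (42*b^10
    + 498*b^9 + 26547*b^8 + 218632*b^7 + 1003454*b^6 + 4037150*b^5 + 11065579*b^4 + 17886204*b^3 +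
    16588530*b^2 + 8764308*b + 635040)*x^4 + (84*b^10 + 3156*b^9 + 6339*b^8 + 205274*b^7 +
    1360390*b^6 + 3784258*b^5 + 7854245*b^4 + 13151880*b^3 + 11098710*b^2 + 2646000*b)*x^3 +
    (21*b^10 + 1464*b^9 + 57396*b^8 + 63946*b^7 + 442775*b^6 + 2811422*b^5 + 5960080*b^4 +
    6635160*b^3 + 4215960*b^2)*x^2 + (- 21*b^10 - 834*b^9 - 16446*b^8 + 285564*b^7 + 532815*b^6 +
    397938*b^5 + 2649780*b^4 + 3118500*b^3)*x - 90*b^9 - 3420*b^8 - 140580*b^7 + 97920*b^6 +
    1229310*b^5 + 994140*b^4)"

definition psum6 :: "real \<Rightarrow> real \<Rightarrow> real" where
  "psum6 b x = x * (x + 1) *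
    ((97020*b^11 + 4000920*b^10 + 71785560*b^9 + 738784200*b^8 + 4836604080*b^7 + 21095298840*b^6 +
    62354578440*b^5 + 124477445400*b^4 + 163926724500*b^3 + 135324105840*b^2 + 63023637600*b +
    12573792000)*x^10 + (264600*b^12 + 10423980*b^11 + 180155640*b^10 + 1808986200*b^9 +
    11780888280*b^8 + 52635402960*b^7 + 166613629560*b^6 + 380551806600*b^5 + 630431321520*b^4 +
    746089912260*b^3 + 599191916400*b^2 + 289970604000*b + 62868960000)*x^9 + (258720*b^13 +
    9511320*b^12 + 157342080*b^11 + 1570588740*b^10 + 10684258872*b^9 + 52772166132*b^8 +
    195109201224*b^7 + 543358741548*b^6 + 1126961175144*b^5 + 1702897086660*b^4 + 1821003944760*b^3
    + 1320085166400*b^2 + 592515000000*b + 125737920000)*x^8 + (107800*b^14 + 3535840*b^13 +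
    57252300*b^12 + 624602160*b^11 + 5031126380*b^10 + 30279882808*b^9 + 135469305748*b^8 +
    450352754376*b^7 + 1118358592652*b^6 + 2083541289256*b^5 + 2885756393520*b^4 +
    2863320573960*b^3 + 1889283765600*b^2 + 730826712000*b + 125737920000)*x^7 + (17325*b^15 +
    463925*b^14 + 9499490*b^13 + 148305360*b^12 + 1538496855*b^11 + 10919762035*b^10 +
    56545990172*b^9 + 223533931922*b^8 + 683832992934*b^7 + 1598469203338*b^6 + 2785408588844*b^5 +
    3525714658620*b^4 + 3139087685580*b^3 + 1835764484400*b^2 + 591741612000*b + 62868960000)*x^6 +
    (660*b^16 + 17655*b^15 + 1312795*b^14 + 24722830*b^13 + 261726900*b^12 + 2164774365*b^11 +
    14588249285*b^10 + 74600216668*b^9 + 280596449998*b^8 + 785131804146*b^7 + 1669274827862*b^6 +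
    2699863357156*b^5 + 3189820801860*b^4 + 2543840602380*b^3 + 1226370000240*b^2 + 289351893600*b
    + 12573792000)*x^5 + (1650*b^16 + 104775*b^15 + 895565*b^14 + 20858090*b^13 + 347080530*b^12 +
    2915841945*b^11 + 15887164915*b^10 + 67929452768*b^9 + 240766437278*b^8 + 670794282546*b^7 +
    1385415008182*b^6 + 2057575995356*b^5 + 2147339289480*b^4 + 1476198690120*b^3 +
    550038535200*b^2 + 62868960000*b)*x^4 + (660*b^16 + 66165*b^15 + 3974377*b^14 + 30703882*b^13 +
    141663264*b^12 + 1477414923*b^11 + 12271929587*b^10 + 57771901780*b^9 + 179705388958*b^8 +
    431374989966*b^7 + 836587083974*b^6 + 1198326934924*b^5 + 1110081999180*b^4 + 575431524360*b^3
    + 126366609600*b^2)*x^3 + (- 660*b^16 - 41910*b^15 - 1489972*b^14 + 32694068*b^13 +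
    413489796*b^12 + 1572719472*b^11 + 3875780068*b^10 + 19122722180*b^9 + 90620635472*b^8 +
    253959944934*b^7 + 445734389536*b^6 + 521213036456*b^5 + 382978725360*b^4 +
    128465568000*b^3)*x^2 + (- 110*b^16 - 15070*b^15 - 645238*b^14 - 38861768*b^13 - 180921306*b^12
    + 806257128*b^11 + 7030379042*b^10 + 17653563520*b^9 + 30169717288*b^8 + 78076561406*b^7 +
    167737689684*b^6 + 175575403584*b^5 + 67316689440*b^4)*x + 110*b^16 + 8140*b^15 + 236368*b^14 +
    7071548*b^13 - 61778844*b^12 - 1072216668*b^11 - 3855683672*b^10 - 280993228*b^9 +
    25623223454*b^8 + 57402895168*b^7 + 50144242584*b^6 + 15793475040*b^5)"

section \<open>Verification of the closed forms\<close>

context laguerre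
begin

text \<open>The recurrence and the initial values determine the coefficients, so a guessed closed
  form only has to satisfy the same relations. These are required for all real x, hence are pure
  polynomial identities; K is the ratio of consecutive normalising factors and keeps them free of
  denominators.\<close>

lemma coeff_chi_Suc:
  fixes E E' F' :: "real \<Rightarrow> real"
  assumes E: "\<And>j. D * coeff (chi j) k = E (real j)"
    and F0: "F' 0 = 0" and E0: "E' 0 = 0"
    and F: "\<And>x. (x + (\<alpha> + 1)) * F' (x + 1) = (x + 1) * (F' x + K * E x)"
    and E': "\<And>x. E' (x + 1) = E' x + F' (x + 1)"
    and D': "D' = K * D"
  shows "D' * coeff (chi n) (Suc k) = E' (real n)"
proof -
  have "D' * coeff (dchi n) (Suc k) = F' (real n) \<and> D' * coeff (chi n) (Suc k) = E' (real n)"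
  proof (induction n)
    case 0
    then show ?case by (simp add: F0 E0)
  next
    case (Suc j)
    have pos: "real j + (\<alpha> + 1) > 0" using \<alpha> by simp
    have "(real j + (\<alpha> + 1)) * (D' * coeff (dchi (Suc j)) (Suc k)) =
        (real j + 1) * (D' * coeff (dchi j) (Suc k) + K * (D * coeff (chi j) k))"
      using pos by (simp add: dchi.simps D' add_ac field_simps)
    also have "\<dots> = (real j + (\<alpha> + 1)) * F' (real j + 1)"
      using Suc by (simp only: F E)
    finally have "D' * coeff (dchi (Suc j)) (Suc k) = F' (real (Suc j))"
      using pos by (simp add: add_ac)
    then show ?case
      using Suc E'[of "real j"] by (simp add: chi_Suc distrib_left add_ac)
  qed
  then show ?thesis ..
qed

lemma coeff_chi_0: "coeff (chi n) 0 = 1"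
  using chi_0[of n] by (simp add: poly_0_coeff_0)

lemma coeff_chi_1:
  fixes n :: nat
  defines "b \<equiv> \<alpha> + 1"
  shows "2 * b * coeff (chi n) 1 = esym1 b (real n)"
proof -
  have "2 * b * coeff (chi n) (Suc 0) = esym1 b (real n)"
  proof (rule coeff_chi_Suc[where F' = "desym1 b" and E = "\<lambda>_. 1" and K = "2 * b"])
    show "1 * coeff (chi j) 0 = 1" for j
      by (simp add: coeff_chi_0)
    show "(x + (\<alpha> + 1)) * desym1 b (x + 1) = (x + 1) * (desym1 b x + 2 * b * 1)" for x
      unfolding b_def[symmetric] esym1_def desym1_def by algebra
    show "esym1 b (x + 1) = esym1 b x + desym1 b (x + 1)" for x
      unfolding esym1_def desym1_def by algebra
    show "2 * b = 2 * b * 1"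
      by algebra
  qed (simp_all add: esym1_def desym1_def)
  then show ?thesis by simp
qed

lemma coeff_chi_2:
  fixes n :: nat
  defines "b \<equiv> \<alpha> + 1"
  shows "24 * b * (b + 1) * (b + 2) * coeff (chi n) 2 = esym2 b (real n)"
proof -
  have "24 * b * (b + 1) * (b + 2) * coeff (chi n) (Suc 1) = esym2 b (real n)"
  proof (rule coeff_chi_Suc[where F' = "desym2 b" and E = "esym1 b" and K = "12 * (b + 1) * (b +
      2)"])
    show "(2 * b) * coeff (chi j) 1 = esym1 b (real j)" for j
      using coeff_chi_1[of j] by (simp add: b_def)
    show "(x + (\<alpha> + 1)) * desym2 b (x + 1) = (x + 1) * (desym2 b x + 12 * (b + 1) * (b + 2) *
        esym1 b x)" for x
      unfolding b_def[symmetric] esym2_def desym2_def esym1_def by algebra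
    show "esym2 b (x + 1) = esym2 b x + desym2 b (x + 1)" for x
      unfolding esym2_def desym2_def esym1_def by algebra
    show "24 * b * (b + 1) * (b + 2) = 12 * (b + 1) * (b + 2) * (2 * b)"
      by algebra
  qed (simp_all add: esym2_def desym2_def)
  then show ?thesis unfolding Suc_1 .
qed

lemma coeff_chi_3:
  fixes n :: nat
  defines "b \<equiv> \<alpha> + 1"
  shows "240 * b * (b + 1) * (b + 2) * (b + 3) * (b + 4) * coeff (chi n) 3 = esym3 b (real n)"
proof -
  have "240 * b * (b + 1) * (b + 2) * (b + 3) * (b + 4) * coeff (chi n) (Suc 2) = esym3 b (real n)"
  proof (rule coeff_chi_Suc[where F' = "desym3 b" and E = "esym2 b" and K = "10 * (b + 3) * (b +
      4)"])
    show "(24 * b * (b + 1) * (b + 2)) * coeff (chi j) 2 = esym2 b (real j)" for j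
      using coeff_chi_2[of j] by (simp add: b_def)
    show "(x + (\<alpha> + 1)) * desym3 b (x + 1) = (x + 1) * (desym3 b x + 10 * (b + 3) * (b + 4) *
        esym2 b x)" for x
      unfolding b_def[symmetric] esym3_def desym3_def esym2_def by algebra
    show "esym3 b (x + 1) = esym3 b x + desym3 b (x + 1)" for x
      unfolding esym3_def desym3_def esym2_def by algebra
    show "240 * b * (b + 1) * (b + 2) * (b + 3) * (b + 4) = 10 * (b + 3) * (b + 4) * (24 * b * (b
        + 1) * (b + 2))"
      by algebra
  qed (simp_all add: esym3_def desym3_def)
  then show ?thesis by simp
qed

lemma coeff_chi_4:
  fixes n :: nat
  defines "b \<equiv> \<alpha> + 1"
  shows "40320 * b * (b + 1) * (b + 2) * (b + 3) * (b + 4) * (b + 5) * (b + 6) * coeff (chi n) 4 =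
      esym4 b (real n)"
proof -
  have "40320 * b * (b + 1) * (b + 2) * (b + 3) * (b + 4) * (b + 5) * (b + 6) * coeff (chi n) (Suc
      3) = esym4 b (real n)"
  proof (rule coeff_chi_Suc[where F' = "desym4 b" and E = "esym3 b" and K = "168 * (b + 5) * (b +
      6)"])
    show "(240 * b * (b + 1) * (b + 2) * (b + 3) * (b + 4)) * coeff (chi j) 3 = esym3 b (real j)"
        for j
      using coeff_chi_3[of j] by (simp add: b_def)
    show "(x + (\<alpha> + 1)) * desym4 b (x + 1) = (x + 1) * (desym4 b x + 168 * (b + 5) * (b + 6) *
        esym3 b x)" for x
      unfolding b_def[symmetric] esym4_def desym4_def esym3_def by algebra
    show "esym4 b (x + 1) = esym4 b x + desym4 b (x + 1)" for x
      unfolding esym4_def desym4_def esym3_def by algebra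
    show "40320 * b * (b + 1) * (b + 2) * (b + 3) * (b + 4) * (b + 5) * (b + 6) = 168 * (b + 5) *
        (b + 6) * (240 * b * (b + 1) * (b + 2) * (b + 3) * (b + 4))"
      by algebra
  qed (simp_all add: esym4_def desym4_def)
  then show ?thesis by simp
qed

lemma coeff_chi_5:
  fixes n :: nat
  defines "b \<equiv> \<alpha> + 1"
  shows "80640 * b * (b + 1) * (b + 2) * (b + 3) * (b + 4) * (b + 5) * (b + 6) * (b + 7) * (b + 8)
      * coeff (chi n) 5 = esym5 b (real n)"
proof -
  have "80640 * b * (b + 1) * (b + 2) * (b + 3) * (b + 4) * (b + 5) * (b + 6) * (b + 7) * (b + 8)
      * coeff (chi n) (Suc 4) = esym5 b (real n)"
  proof (rule coeff_chi_Suc[where F' = "desym5 b" and E = "esym4 b" and K = "2 * (b + 7) * (b +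
      8)"])
    show "(40320 * b * (b + 1) * (b + 2) * (b + 3) * (b + 4) * (b + 5) * (b + 6)) * coeff (chi j)
        4 = esym4 b (real j)" for j
      using coeff_chi_4[of j] by (simp add: b_def)
    show "(x + (\<alpha> + 1)) * desym5 b (x + 1) = (x + 1) * (desym5 b x + 2 * (b + 7) * (b + 8) * esym4
        b x)" for x
      unfolding b_def[symmetric] esym5_def desym5_def esym4_def by algebra
    show "esym5 b (x + 1) = esym5 b x + desym5 b (x + 1)" for x
      unfolding esym5_def desym5_def esym4_def by algebra
    show "80640 * b * (b + 1) * (b + 2) * (b + 3) * (b + 4) * (b + 5) * (b + 6) * (b + 7) * (b +
        8) = 2 * (b + 7) * (b + 8) * (40320 * b * (b + 1) * (b + 2) * (b + 3) * (b + 4) * (b + 5)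
        * (b + 6))"
      by algebra
  qed (simp_all add: esym5_def desym5_def)
  then show ?thesis by simp
qed

lemma coeff_chi_6:
  fixes n :: nat
  defines "b \<equiv> \<alpha> + 1"
  shows "159667200 * b * (b + 1) * (b + 2) * (b + 3) * (b + 4) * (b + 5) * (b + 6) * (b + 7) * (b
      + 8) * (b + 9) * (b + 10) * coeff (chi n) 6 = esym6 b (real n)"
proof -
  have "159667200 * b * (b + 1) * (b + 2) * (b + 3) * (b + 4) * (b + 5) * (b + 6) * (b + 7) * (b +
      8) * (b + 9) * (b + 10) * coeff (chi n) (Suc 5) = esym6 b (real n)"
  proof (rule coeff_chi_Suc[where F' = "desym6 b" and E = "esym5 b" and K = "1980 * (b + 9) * (b +
      10)"])
    show "(80640 * b * (b + 1) * (b + 2) * (b + 3) * (b + 4) * (b + 5) * (b + 6) * (b + 7) * (b +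
        8)) * coeff (chi j) 5 = esym5 b (real j)" for j
      using coeff_chi_5[of j] by (simp add: b_def)
    show "(x + (\<alpha> + 1)) * desym6 b (x + 1) = (x + 1) * (desym6 b x + 1980 * (b + 9) * (b + 10) *
        esym5 b x)" for x
      unfolding b_def[symmetric] esym6_def desym6_def esym5_def by algebra
    show "esym6 b (x + 1) = esym6 b x + desym6 b (x + 1)" for x
      unfolding esym6_def desym6_def esym5_def by algebra
    show "159667200 * b * (b + 1) * (b + 2) * (b + 3) * (b + 4) * (b + 5) * (b + 6) * (b + 7) * (b
        + 8) * (b + 9) * (b + 10) = 1980 * (b + 9) * (b + 10) * (80640 * b * (b + 1) * (b + 2) *
        (b + 3) * (b + 4) * (b + 5) * (b + 6) * (b + 7) * (b + 8))"
      by algebra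
  qed (simp_all add: esym6_def desym6_def)
  then show ?thesis by simp
qed

section \<open>Power sums of the eigenvalues\<close>

lemma newton_evs:
  fixes n :: nat
  defines "e \<equiv> coeff (chi n)" and "p \<equiv> power_sum (evs n)"
  shows "p 1 = e 1"
    and "p 2 = e 1 * p 1 - 2 * e 2"
    and "p 3 = e 1 * p 2 - e 2 * p 1 + 3 * e 3"
    and "p 4 = e 1 * p 3 - e 2 * p 2 + e 3 * p 1 - 4 * e 4"
    and "p 5 = e 1 * p 4 - e 2 * p 3 + e 3 * p 2 - e 4 * p 1 + 5 * e 5"
    and "p 6 = e 1 * p 5 - e 2 * p 4 + e 3 * p 3 - e 4 * p 2 + e 5 * p 1 - 6 * e 6"
proof -
  have newton: "(real k + 1) * e (Suc k) = (\<Sum>i\<le>k. (- 1) ^ i * e (k - i) * p (Suc i))" for k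
    using newton_identity[of k "evs n"] by (simp add: e_def p_def flip: evs(2))
  have "e 0 = 1" by (simp add: e_def coeff_chi_0)
  then show "p 1 = e 1" "p 2 = e 1 * p 1 - 2 * e 2" "p 3 = e 1 * p 2 - e 2 * p 1 + 3 * e 3"
    "p 4 = e 1 * p 3 - e 2 * p 2 + e 3 * p 1 - 4 * e 4"
    "p 5 = e 1 * p 4 - e 2 * p 3 + e 3 * p 2 - e 4 * p 1 + 5 * e 5"
    "p 6 = e 1 * p 5 - e 2 * p 4 + e 3 * p 3 - e 4 * p 2 + e 5 * p 1 - 6 * e 6"
    using newton[of 0] newton[of 1] newton[of 2] newton[of 3] newton[of 4] newton[of 5]
    by (simp_all add: numeral_eq_Suc)
qed

lemma power_sum_evs_1:
  fixes n :: nat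
  defines "b \<equiv> \<alpha> + 1"
  shows "2 * b * power_sum (evs n) 1 = psum1 b (real n)"
  using coeff_chi_1[of n] newton_evs(1)[of n] by (simp add: b_def esym1_def psum1_def algebra_simps)

lemma power_sum_evs_2:
  fixes n :: nat
  defines "b \<equiv> \<alpha> + 1"
  shows "6 * b^2 * (b + 1) * (b + 2) * power_sum (evs n) 2 = psum2 b (real n)"
proof -
  \<comment> \<open>Newton's identity is multiplied by a common factor so that each coefficient and
    each power sum appears with its own normaliser and can be replaced by its closed form. The outer
    constant makes all weights integral and is cancelled at the end.\<close>
  have "4 * (6 * b^2 * (b + 1) * (b + 2) * power_sum (evs n) 2) =
      (6 * (b + 1) * (b + 2)) * ((2 * b) * coeff (chi n) 1) *
        ((2 * b) * power_sum (evs n) 1)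
      - (2 * b) * ((24 * b * (b + 1) * (b + 2)) * coeff (chi n) 2)"
    unfolding newton_evs(2) by algebra
  also have "\<dots> =
      (6 * (b + 1) * (b + 2)) * esym1 b (real n) * psum1 b (real n)
      - (2 * b) * esym2 b (real n)"
    by (simp only: coeff_chi_1[of n, folded b_def] coeff_chi_2[of n, folded b_def]
      power_sum_evs_1[of n, folded b_def])
  also have "\<dots> = 4 * psum2 b (real n)"
    unfolding esym1_def esym2_def psum1_def psum2_def by algebra
  finally show ?thesis
    by (rule mult_left_cancel[THEN iffD1, rotated]) simp
qed

lemma power_sum_evs_3:
  fixes n :: nat
  defines "b \<equiv> \<alpha> + 1"
  shows "20 * b^3 * (b + 1) * (b + 2) * (b + 3) * (b + 4) * power_sum (evs n) 3 = psum3 b (real n)"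
proof -
  have "12 * (20 * b^3 * (b + 1) * (b + 2) * (b + 3) * (b + 4) * power_sum (evs n) 3) =
      (20 * (b + 3) * (b + 4)) * ((2 * b) * coeff (chi n) 1) *
        ((6 * b^2 * (b + 1) * (b + 2)) * power_sum (evs n) 2)
      - (5 * b * (b + 3) * (b + 4)) * ((24 * b * (b + 1) * (b + 2)) * coeff (chi n) 2) *
        ((2 * b) * power_sum (evs n) 1)
      + (3 * b^2) * ((240 * b * (b + 1) * (b + 2) * (b + 3) * (b + 4)) * coeff (chi n) 3)"
    unfolding newton_evs(3) by algebra
  also have "\<dots> =
      (20 * (b + 3) * (b + 4)) * esym1 b (real n) * psum2 b (real n)
      - (5 * b * (b + 3) * (b + 4)) * esym2 b (real n) * psum1 b (real n)
      + (3 * b^2) * esym3 b (real n)"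
    by (simp only: coeff_chi_1[of n, folded b_def] coeff_chi_2[of n, folded b_def] coeff_chi_3[of
        n, folded b_def]
      power_sum_evs_1[of n, folded b_def] power_sum_evs_2[of n, folded b_def])
  also have "\<dots> = 12 * psum3 b (real n)"
    unfolding esym1_def esym2_def esym3_def psum1_def psum2_def psum3_def by algebra
  finally show ?thesis
    by (rule mult_left_cancel[THEN iffD1, rotated]) simp
qed

lemma power_sum_evs_4:
  fixes n :: nat
  defines "b \<equiv> \<alpha> + 1"
  shows "210 * b^4 * (b + 1)^2 * (b + 2)^2 * (b + 3) * (b + 4) * (b + 5) * (b + 6) * power_sum
      (evs n) 4 = psum4 b (real n)"
proof -
  \<comment> \<open>The squares of b + 1 and b + 2 in the normaliser come from the product of the
    second coefficient and the second power sum, each of which carries both factors in its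
    denominator.\<close>
  have "192 * (210 * b^4 * (b + 1)^2 * (b + 2)^2 * (b + 3) * (b + 4) * (b + 5) * (b + 6) *
      power_sum (evs n) 4) =
      (1008 * (b + 1) * (b + 2) * (b + 5) * (b + 6)) * ((2 * b) * coeff (chi n) 1) *
        ((20 * b^3 * (b + 1) * (b + 2) * (b + 3) * (b + 4)) * power_sum (evs n) 3)
      - (280 * b * (b + 3) * (b + 4) * (b + 5) * (b + 6)) * ((24 * b * (b + 1) * (b + 2)) * coeff
          (chi n) 2) *
        ((6 * b^2 * (b + 1) * (b + 2)) * power_sum (evs n) 2)
      + (84 * b^2 * (b + 1) * (b + 2) * (b + 5) * (b + 6)) * ((240 * b * (b + 1) * (b + 2) * (b +
          3) * (b + 4)) * coeff (chi n) 3) *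
        ((2 * b) * power_sum (evs n) 1)
      - (4 * b^3 * (b + 1) * (b + 2)) * ((40320 * b * (b + 1) * (b + 2) * (b + 3) * (b + 4) * (b +
          5) * (b + 6)) * coeff (chi n) 4)"
    unfolding newton_evs(4) by algebra
  also have "\<dots> =
      (1008 * (b + 1) * (b + 2) * (b + 5) * (b + 6)) * esym1 b (real n) * psum3 b (real n)
      - (280 * b * (b + 3) * (b + 4) * (b + 5) * (b + 6)) * esym2 b (real n) * psum2 b (real n)
      + (84 * b^2 * (b + 1) * (b + 2) * (b + 5) * (b + 6)) * esym3 b (real n) * psum1 b (real n)
      - (4 * b^3 * (b + 1) * (b + 2)) * esym4 b (real n)"
    by (simp only: coeff_chi_1[of n, folded b_def] coeff_chi_2[of n, folded b_def] coeff_chi_3[of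
        n, folded b_def] coeff_chi_4[of n, folded b_def]
      power_sum_evs_1[of n, folded b_def] power_sum_evs_2[of n, folded b_def] power_sum_evs_3[of
          n, folded b_def])
  also have "\<dots> = 192 * psum4 b (real n)"
    unfolding esym1_def esym2_def esym3_def esym4_def psum1_def psum2_def psum3_def psum4_def by
        algebra
  finally show ?thesis
    by (rule mult_left_cancel[THEN iffD1, rotated]) simp
qed

lemma power_sum_evs_5:
  fixes n :: nat
  defines "b \<equiv> \<alpha> + 1"
  shows "252 * b^5 * (b + 1)^2 * (b + 2)^2 * (b + 3) * (b + 4) * (b + 5) * (b + 6) * (b + 7) * (b
      + 8) * power_sum (evs n) 5 = psum5 b (real n)"
proof -
  have "320 * (252 * b^5 * (b + 1)^2 * (b + 2)^2 * (b + 3) * (b + 4) * (b + 5) * (b + 6) * (b + 7)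
      * (b + 8) * power_sum (evs n) 5) =
      (192 * (b + 7) * (b + 8)) * ((2 * b) * coeff (chi n) 1) *
        ((210 * b^4 * (b + 1)^2 * (b + 2)^2 * (b + 3) * (b + 4) * (b + 5) * (b + 6)) * power_sum
            (evs n) 4)
      - (168 * b * (b + 5) * (b + 6) * (b + 7) * (b + 8)) * ((24 * b * (b + 1) * (b + 2)) * coeff
          (chi n) 2) *
        ((20 * b^3 * (b + 1) * (b + 2) * (b + 3) * (b + 4)) * power_sum (evs n) 3)
      + (56 * b^2 * (b + 5) * (b + 6) * (b + 7) * (b + 8)) * ((240 * b * (b + 1) * (b + 2) * (b +
          3) * (b + 4)) * coeff (chi n) 3) *
        ((6 * b^2 * (b + 1) * (b + 2)) * power_sum (evs n) 2)
      - (b^3 * (b + 1) * (b + 2) * (b + 7) * (b + 8)) * ((40320 * b * (b + 1) * (b + 2) * (b + 3)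
          * (b + 4) * (b + 5) * (b + 6)) * coeff (chi n) 4) *
        ((2 * b) * power_sum (evs n) 1)
      + (5 * b^4 * (b + 1) * (b + 2)) * ((80640 * b * (b + 1) * (b + 2) * (b + 3) * (b + 4) * (b +
          5) * (b + 6) * (b + 7) * (b + 8)) * coeff (chi n) 5)"
    unfolding newton_evs(5) by algebra
  also have "\<dots> =
      (192 * (b + 7) * (b + 8)) * esym1 b (real n) * psum4 b (real n)
      - (168 * b * (b + 5) * (b + 6) * (b + 7) * (b + 8)) * esym2 b (real n) * psum3 b (real n)
      + (56 * b^2 * (b + 5) * (b + 6) * (b + 7) * (b + 8)) * esym3 b (real n) * psum2 b (real n)
      - (b^3 * (b + 1) * (b + 2) * (b + 7) * (b + 8)) * esym4 b (real n) * psum1 b (real n)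
      + (5 * b^4 * (b + 1) * (b + 2)) * esym5 b (real n)"
    by (simp only: coeff_chi_1[of n, folded b_def] coeff_chi_2[of n, folded b_def] coeff_chi_3[of
        n, folded b_def] coeff_chi_4[of n, folded b_def] coeff_chi_5[of n, folded b_def]
      power_sum_evs_1[of n, folded b_def] power_sum_evs_2[of n, folded b_def] power_sum_evs_3[of
          n, folded b_def] power_sum_evs_4[of n, folded b_def])
  also have "\<dots> = 320 * psum5 b (real n)"
    unfolding esym1_def esym2_def esym3_def esym4_def esym5_def psum1_def psum2_def psum3_def
        psum4_def
    psum5_def by algebra
  finally show ?thesis
    by (rule mult_left_cancel[THEN iffD1, rotated]) simp
qed

lemma power_sum_evs_6:
  fixes n :: nat
  defines "b \<equiv> \<alpha> + 1"
  shows "4620 * b^6 * (b + 1)^3 * (b + 2)^3 * (b + 3)^2 * (b + 4)^2 * (b + 5) * (b + 6) * (b + 7)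
      * (b + 8) * (b + 9) * (b + 10) * power_sum (evs n) 6 = psum6 b (real n)"
proof -
  \<comment> \<open>The cubes come from the product of the second coefficient and p_4, the squares
    of b + 3 and b + 4 from that of the third coefficient and p_3.\<close>
  have "34560 * (4620 * b^6 * (b + 1)^3 * (b + 2)^3 * (b + 3)^2 * (b + 4)^2 * (b + 5) * (b + 6) *
      (b + 7) * (b + 8) * (b + 9) * (b + 10) * power_sum (evs n) 6) =
      (316800 * (b + 1) * (b + 2) * (b + 3) * (b + 4) * (b + 9) * (b + 10)) * ((2 * b) * coeff
          (chi n) 1) *
        ((252 * b^5 * (b + 1)^2 * (b + 2)^2 * (b + 3) * (b + 4) * (b + 5) * (b + 6) * (b + 7) * (b
            + 8)) * power_sum (evs n) 5)
      - (31680 * b * (b + 3) * (b + 4) * (b + 7) * (b + 8) * (b + 9) * (b + 10)) * ((24 * b * (b +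
          1) * (b + 2)) * coeff (chi n) 2) *
        ((210 * b^4 * (b + 1)^2 * (b + 2)^2 * (b + 3) * (b + 4) * (b + 5) * (b + 6)) * power_sum
            (evs n) 4)
      + (33264 * b^2 * (b + 1) * (b + 2) * (b + 5) * (b + 6) * (b + 7) * (b + 8) * (b + 9) * (b +
          10)) * ((240 * b * (b + 1) * (b + 2) * (b + 3) * (b + 4)) * coeff (chi n) 3) *
        ((20 * b^3 * (b + 1) * (b + 2) * (b + 3) * (b + 4)) * power_sum (evs n) 3)
      - (660 * b^3 * (b + 1) * (b + 2) * (b + 3) * (b + 4) * (b + 7) * (b + 8) * (b + 9) * (b +
          10)) * ((40320 * b * (b + 1) * (b + 2) * (b + 3) * (b + 4) * (b + 5) * (b + 6)) * coeff
          (chi n) 4) *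
        ((6 * b^2 * (b + 1) * (b + 2)) * power_sum (evs n) 2)
      + (990 * b^4 * (b + 1)^2 * (b + 2)^2 * (b + 3) * (b + 4) * (b + 9) * (b + 10)) * ((80640 * b
          * (b + 1) * (b + 2) * (b + 3) * (b + 4) * (b + 5) * (b + 6) * (b + 7) * (b + 8)) * coeff
          (chi n) 5) *
        ((2 * b) * power_sum (evs n) 1)
      - (6 * b^5 * (b + 1)^2 * (b + 2)^2 * (b + 3) * (b + 4)) * ((159667200 * b * (b + 1) * (b +
          2) * (b + 3) * (b + 4) * (b + 5) * (b + 6) * (b + 7) * (b + 8) * (b + 9) * (b + 10)) *
          coeff (chi n) 6)"
    unfolding newton_evs(6) by algebra
  also have "\<dots> =
      (316800 * (b + 1) * (b + 2) * (b + 3) * (b + 4) * (b + 9) * (b + 10)) * esym1 b (real n) *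
          psum5 b (real n)
      - (31680 * b * (b + 3) * (b + 4) * (b + 7) * (b + 8) * (b + 9) * (b + 10)) * esym2 b (real
          n) * psum4 b (real n)
      + (33264 * b^2 * (b + 1) * (b + 2) * (b + 5) * (b + 6) * (b + 7) * (b + 8) * (b + 9) * (b +
          10)) * esym3 b (real n) * psum3 b (real n)
      - (660 * b^3 * (b + 1) * (b + 2) * (b + 3) * (b + 4) * (b + 7) * (b + 8) * (b + 9) * (b +
          10)) * esym4 b (real n) * psum2 b (real n)
      + (990 * b^4 * (b + 1)^2 * (b + 2)^2 * (b + 3) * (b + 4) * (b + 9) * (b + 10)) * esym5 b
          (real n) * psum1 b (real n)
      - (6 * b^5 * (b + 1)^2 * (b + 2)^2 * (b + 3) * (b + 4)) * esym6 b (real n)"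
    by (simp only: coeff_chi_1[of n, folded b_def] coeff_chi_2[of n, folded b_def] coeff_chi_3[of
        n, folded b_def] coeff_chi_4[of n, folded b_def] coeff_chi_5[of n, folded b_def]
        coeff_chi_6[of n, folded b_def]
      power_sum_evs_1[of n, folded b_def] power_sum_evs_2[of n, folded b_def] power_sum_evs_3[of
          n, folded b_def] power_sum_evs_4[of n, folded b_def] power_sum_evs_5[of n, folded b_def])
  also have "\<dots> = 34560 * psum6 b (real n)"
    unfolding esym1_def esym2_def esym3_def esym4_def esym5_def esym6_def psum1_def psum2_def
        psum3_def
    psum4_def psum5_def psum6_def by algebra
  finally show ?thesis
    by (rule mult_left_cancel[THEN iffD1, rotated]) simp
qed

end

section \<open>The polynomial inequalities\<close>

lemma psum3_le:
  fixes b x :: real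
  assumes "b > 0" "x \<ge> 1"
  shows "25 * psum3 b x \<le> 4 * (b + 1) * (b + 3) * (x + 1)^3 * (5 * x + 2 * b)^3"
proof -
  define y where "y = x - 1"
  have "y \<ge> 0" "x = y + 1" using assms by (auto simp: y_def)
  \<comment> \<open>This is the difference of the two sides, with the common factor x + 1 = y + 2
    kept outside. The terms in x^6 cancel, and so does b^3 x^5; these two cancellations determine
    the leading factor and the 2/5 of the bound.\<close>
  have "0 \<le> (y + 2) * ((1500*b^2 + 3300*b)*y^4 + (115*b^4 + 1885*b^3 + 8670*b^2 + 14550*b)*y^3 +
      (32*b^5 + 828*b^4 +
    6796*b^3 + 20700*b^2 + 21900*b)*y^2 + (128*b^5 + 1807*b^4 + 8939*b^3 + 19260*b^2 + 13350*b)*y +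
    128*b^5 + 1222*b^4 + 4124*b^3 + 5730*b^2 + 2700*b)"
    using \<open>b > 0\<close> \<open>y \<ge> 0\<close> by (intro mult_nonneg_nonneg add_nonneg_nonneg) simp_all
  also have "\<dots> = 4 * (b + 1) * (b + 3) * (x + 1)^3 * (5 * x + 2 * b)^3 - 25 * psum3 b x"
    unfolding psum3_def \<open>x = y + 1\<close> by algebra
  finally show ?thesis by simp
qed

lemma psum4_le:
  fixes b x :: real
  assumes "b > 0" "x \<ge> 1"
  shows "343 * psum4 b x \<le> 15 * (b + 1)^2 * (b + 3) * (b + 5) * (5 * b + 12) * (x + 1)^4 * (7 * x
      + 3 * b)^4"
proof -
  define y where "y = x - 1"
  have "y \<ge> 0" "x = y + 1" using assms by (auto simp: y_def)
  have "0 \<le> (y + 2) * ((905520*b^5 + 8808240*b^4 + 29717520*b^3 + 41571600*b^2 + 19756800*b)*y^6 +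
      (54390*b^7 +
    2038890*b^6 + 21204260*b^5 + 104326880*b^4 + 264358430*b^3 + 324889110*b^2 + 147558600*b)*y^5 +
    (42294*b^8 + 1455132*b^7 + 19122054*b^6 + 129390968*b^5 + 479510402*b^4 + 988541540*b^3 +
    1053235890*b^2 + 440206200*b)*y^4 + (6075*b^9 + 392997*b^8 + 7788396*b^7 + 72535722*b^6 +
    371845939*b^5 + 1117985581*b^4 + 1946677390*b^3 + 1795678500*b^2 + 669879000*b)*y^3 +
    (36450*b^9 + 1318916*b^8 + 18367328*b^7 + 133561806*b^6 + 561874562*b^5 + 1418030888*b^4 +
    2103495940*b^3 + 1674654870*b^2 + 547633800*b)*y^2 + (72900*b^9 + 1913108*b^8 + 20708954*b^7 +
    121904958*b^6 + 429787996*b^5 + 921651124*b^4 + 1167897990*b^3 + 800201850*b^2 + 227203200*b)*y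
    + 48600*b^9 + 1020225*b^8 + 9069480*b^7 + 44493120*b^6 + 131312310*b^5 + 237832755*b^4 +
    257178810*b^3 + 151307100*b^2 + 37044000*b)"
    using \<open>b > 0\<close> \<open>y \<ge> 0\<close> by (intro mult_nonneg_nonneg add_nonneg_nonneg) simp_all
  also have "\<dots> = 15 * (b + 1)^2 * (b + 3) * (b + 5) * (5 * b + 12) * (x + 1)^4 * (7 * x + 3 * b)^4
      - 343 * psum4 b x"
    unfolding psum4_def \<open>x = y + 1\<close> by algebra
  finally show ?thesis by simp
qed

lemma psum5_le:
  fixes b x :: real
  assumes "b > 0" "x \<ge> 1"
  shows "6561 * psum5 b x \<le> 28 * (b + 1)^2 * (b + 3) * (b + 5) * (b + 7) * (7 * b + 24) * (x +
      1)^5 * (9 * x + 4 * b)^5"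
proof -
  define y where "y = x - 1"
  have "y \<ge> 0" "x = y + 1" using assms by (auto simp: y_def)
  have "0 \<le> (y + 2) * ((85424220*b^6 + 1436596560*b^5 + 8988832440*b^4 + 26097558480*b^3 +
      34662943980*b^2 +
    16203045600*b)*y^8 + (4261005*b^8 + 260814330*b^7 + 4215026970*b^6 + 32306327550*b^5 +
    135992934315*b^4 + 317574182520*b^3 + 377283415950*b^2 + 170131978800*b)*y^7 + (5436720*b^9 +
    267133950*b^8 + 4800090780*b^7 + 45828452160*b^6 + 256109161500*b^5 + 859244007510*b^4 +
    1695854679120*b^3 + 1792834846740*b^2 + 761543143200*b)*y^6 + (1982358*b^10 + 116121582*b^9 +
    2668498128*b^8 + 32689658718*b^7 + 236278975140*b^6 + 1063159452216*b^5 + 3001169414250*b^4 +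
    5139768850020*b^3 + 4839290329860*b^2 + 1895756335200*b)*y^5 + (200704*b^11 + 22492442*b^10 +
    755988738*b^9 + 12350299090*b^8 + 116655583766*b^7 + 689929497828*b^6 + 2621167856172*b^5 +
    6388150032180*b^4 + 9612982309140*b^3 + 8070023307780*b^2 + 2867939071200*b)*y^4 +
    (1605632*b^11 + 99956311*b^10 + 2407947204*b^9 + 31048882565*b^8 + 242394921508*b^7 +
    1213210193859*b^6 + 3983219766936*b^5 + 8505564916275*b^4 + 11313225057960*b^3 +
    8460661376790*b^2 + 2697807092400*b)*y^3 + (4816896*b^11 + 218507898*b^10 + 4160730942*b^9 +
    44312066160*b^8 + 294323540214*b^7 + 1276197419772*b^6 + 3670272090288*b^5 + 6911715014190*b^4
    + 8143173179820*b^3 + 5414614184700*b^2 + 1539289332000*b)*y^2 + (6422528*b^11 + 235863145*b^10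
    + 3748984140*b^9 + 33984611966*b^8 + 194861498488*b^7 + 740114322741*b^6 + 1876398429096*b^5 +
    3123202800060*b^4 + 3260645437140*b^3 + 1924214541480*b^2 + 486091368000*b)*y + 3211264*b^11 +
    100901570*b^10 + 1383066510*b^9 + 10899527968*b^8 + 54664365644*b^7 + 181992162618*b^6 +
    406170524718*b^5 + 597832178580*b^4 + 553105801080*b^3 + 289314380880*b^2 + 64812182400*b)"
    using \<open>b > 0\<close> \<open>y \<ge> 0\<close> by (intro mult_nonneg_nonneg add_nonneg_nonneg) simp_all
  also have "\<dots> = 28 * (b + 1)^2 * (b + 3) * (b + 5) * (b + 7) * (7 * b + 24) * (x + 1)^5 * (9 * x
      + 4 * b)^5 - 6561 * psum5 b x"
    unfolding psum5_def \<open>x = y + 1\<close> by algebra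
  finally show ?thesis by simp
qed

text \<open>The leading coefficient of \<open>psum6\<close> in x is 4620 times the shifts of b
  displayed here and the cubic, which is how that cubic enters the bound. The factors 5 b + 12 and 7
  b + 24 arise in the same way from \<open>psum4\<close> and \<open>psum5\<close>.\<close>

lemma psum6_le:
  fixes b x :: real
  assumes "b > 0" "x \<ge> 1"
  shows "161051 * psum6 b x \<le> 420 * (b + 1)^3 * (b + 3)^2 * (b + 5) * (b + 7) * (b + 9) * (21 *
      b^3 + 236 * b^2 + 856 * b + 960) * (x + 1)^6 * (11 * x + 5 * b)^6"
proof -
  define y where "y = x - 1"
  have "y \<ge> 0" "x = y + 1" using assms by (auto simp: y_def)
  have "0 \<le> (y + 2) * ((156657528720*b^11 + 5737886375760*b^10 + 90962828787600*b^9 +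
      821967442647120*b^8 +
    4683403445822640*b^7 + 17541804701337840*b^6 + 43597315400007600*b^5 + 70706025735594480*b^4 +
    71282695085965440*b^3 + 40151827863100800*b^2 + 9572830210944000*b)*y^10 + (6757992780*b^13 +
    678222070680*b^12 + 20999315734320*b^11 + 337275019680060*b^10 + 3341080006777128*b^9 +
    22061582724495468*b^8 + 100652071240111776*b^7 + 320953580439420852*b^6 +
    710088669986636556*b^5 + 1060830469581484140*b^4 + 1012206781784222640*b^3 +
    551543323840740000*b^2 + 129417300736416000*b)*y^9 + (11987252200*b^14 + 943775204680*b^13 +
    29009527289820*b^12 + 501713001617520*b^11 + 5595550645768160*b^10 + 42912038519586544*b^9 +
    233690093029518664*b^8 + 916300077038615808*b^7 + 2587179306143833016*b^6 +
    5190562558104155848*b^5 + 7178219509822270140*b^4 + 6460475752253754000*b^3 +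
    3378925639780336800*b^2 + 773006039533728000*b)*y^8 + (7214978925*b^15 + 580520057425*b^14 +
    19715539983370*b^13 + 388934010261720*b^12 + 5020888034312535*b^11 + 45049210705403135*b^10 +
    290606602138239772*b^9 + 1372218168556076842*b^8 + 4771758427802190594*b^7 +
    12164746682148432218*b^6 + 22370723260536574924*b^5 + 28745070195191487060*b^4 +
    24352703549452804680*b^3 + 12146961173169715200*b^2 + 2684442502615104000*b)*y^7 +
    (1712831340*b^16 + 172704684570*b^15 + 7219009517830*b^14 + 171622776251740*b^13 +
    2634046493730300*b^12 + 27971992518267270*b^11 + 213968642235066290*b^10 +
    1206316776220268416*b^9 + 5069486731068497716*b^8 + 15912660822640825452*b^7 +
    37048161594998590124*b^6 + 62860207962673879912*b^5 + 75225736503310008000*b^4 +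
    59898114461951544240*b^3 + 28342019918405793600*b^2 + 5998850870265792000*b)*y^6 +
    (137812500*b^17 + 24790003890*b^16 + 1444945681470*b^15 + 43848930260440*b^14 +
    826855968266380*b^13 + 10592291108717490*b^12 + 96882932568642030*b^11 +
    651802985093495960*b^10 + 3281656510433993152*b^9 + 12462905407447512292*b^8 +
    35695116065295784344*b^7 + 76447986244266078308*b^6 + 120170840149079918044*b^5 +
    134109018632657796420*b^4 + 100210753234412916480*b^3 + 44780049605008317600*b^2 +
    9009321878719008000*b)*y^5 + (1378125000*b^17 + 144758130690*b^16 + 6236091461760*b^15 +
    152778056375398*b^14 + 2432826042943948*b^13 + 27024554212650966*b^12 + 218360239489652472*b^11
    + 1315848603722385998*b^10 + 5996616593428592308*b^9 + 20784665212382702620*b^8 +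
    54699645627041909280*b^7 + 108264256897542365468*b^6 + 158063609138622831952*b^5 +
    164574564323721612060*b^4 + 115219860063723510480*b^3 + 48437294903042522400*b^2 +
    9205196712266016000*b)*y^4 + (5512500000*b^17 + 440517904320*b^16 + 15523107796275*b^15 +
    323642368022689*b^14 + 4497622950126934*b^13 + 44353678339306968*b^12 + 321976341040755831*b^11
    + 1758899081773377119*b^10 + 7319465894422782544*b^9 + 23304923727931356610*b^8 +
    56616679211873691660*b^7 + 103860794017705029434*b^6 + 141022460831765616796*b^5 +
    136964469301456441260*b^4 + 89687882849487005160*b^3 + 35353856837911550400*b^2 +
    6315122453004288000*b)*y^3 + (11025000000*b^17 + 741157088230*b^16 + 22570375447910*b^15 +
    414058704897092*b^14 + 5129598946987792*b^13 + 45564092310788754*b^12 + 300388963538708178*b^11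
    + 1500004633326092792*b^10 + 5735484159994636132*b^9 + 16849288617211619140*b^8 +
    37894570915282410740*b^7 + 64530914669669978832*b^6 + 81521160996426017328*b^5 +
    73805069561945835960*b^4 + 45125479921743310320*b^3 + 16632992496617481600*b^2 +
    2782011733611264000*b)*y^2 + (11025000000*b^17 + 656336989240*b^16 + 17860335121490*b^15 +
    294959153470346*b^14 + 3309634836490996*b^13 + 26762084457635262*b^12 + 161398292328306024*b^11
    + 740619380901910826*b^10 + 2612088575649134524*b^9 + 7098427332613162018*b^8 +
    14800868471845525766*b^7 + 23409751937518313988*b^6 + 27508728051539103600*b^5 +
    23194165114340201520*b^4 + 13219519236226380000*b^3 + 4545770847182611200*b^2 +
    709862178719232000*b)*y + 4410000000*b^17 + 239699972190*b^16 + 5958400108920*b^15 +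
    90012623143380*b^14 + 925714687722300*b^13 + 6875928506657280*b^12 + 38164959926351580*b^11 +
    161461580231303100*b^10 + 525970982119993620*b^9 + 1322775819878867970*b^8 +
    2557302924820220220*b^7 + 3756196049521169520*b^6 + 4103702991680957280*b^5 +
    3219257788692089760*b^4 + 1707852756605244480*b^3 + 546797001403699200*b^2 +
    79528127906304000*b)"
    using \<open>b > 0\<close> \<open>y \<ge> 0\<close> by (intro mult_nonneg_nonneg add_nonneg_nonneg) simp_all
  also have "\<dots> = 420 * (b + 1)^3 * (b + 3)^2 * (b + 5) * (b + 7) * (b + 9) * (21 * b^3 + 236 * b^2
      + 856 * b + 960) * (x + 1)^6 * (11 * x + 5 * b)^6 - 161051 * psum6 b x"
    unfolding psum6_def \<open>x = y + 1\<close> by algebra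
  finally show ?thesis by simp
qed

section \<open>Polynomial inequalities for the lower bounds\<close>

lemma psum3_ge:
  fixes b x :: real
  assumes "b > 0" "x \<ge> 3"
  shows "5 * (b + 3) * (2 * x * (8 * x + 3 * b)) * psum2 b x
    \<le> 12 * psum3 b x"
proof -
  \<comment> \<open>Both power sums contain x (x + 1), which becomes the outer factor (y + 3) (y +
    4) below. Beyond it, the terms in x^4 cancel, and so does b^4 x^2; the latter fixes the fraction
    3/8.\<close>
  define y where "y = x - 3"
  have "y \<ge> 0" "x = y + 3" using assms by (auto simp: y_def)
  \<comment> \<open>The only negative coefficient, of \<open>b\<^sup>2 y\<^sup>3\<close>, is absorbed by \<open>b (b - 1)\<^sup>2 y\<^sup>3\<close>.\<close>
  have "0 \<le> (y + 3) * (y + 4) * ((34*b^3 + 446*b + 720)*y^3 + (184*b^3 + 716*b^2 + 4620*b +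
      7200)*y^2 + (30*b^4 + 546*b^3 +
    4134*b^2 + 17370*b + 23760)*y + 90*b^4 + 1080*b^3 + 7110*b^2 + 22680*b + 25920 + 4 * b * (b -
        1)^2 * y^3)"
    using \<open>b > 0\<close> \<open>y \<ge> 0\<close> by (intro mult_nonneg_nonneg add_nonneg_nonneg) simp_all
  also have "\<dots> = 12 * psum3 b x -
      5 * (b + 3) * (2 * x * (8 * x + 3 * b)) * psum2 b x"
    unfolding psum2_def psum3_def \<open>x = y + 3\<close> by algebra
  finally show ?thesis by simp
qed

lemma psum4_ge:
  fixes b x :: real
  assumes "b > 0" "x \<ge> 1"
  shows "21 * (b + 1) * (b + 5) * ((5 * b + 12) * x * (25 * x + 8 * b)) * psum3 b x
    \<le> 100 * psum4 b x"
proof -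
  define y where "y = x - 1"
  have "y \<ge> 0" "x = y + 1" using assms by (auto simp: y_def)
  have "0 \<le> (y + 1) * (y + 2) * ((10200*b^6 + 72480*b^5 + 323700*b^4 + 1413060*b^3 + 3602340*b^2 +
      4340700*b + 1890000)*y^5 +
    (8715*b^7 + 71691*b^6 + 649615*b^5 + 3920059*b^4 + 13618450*b^3 + 27684930*b^2 + 30069900*b +
    13230000)*y^4 + (10815*b^7 + 393183*b^6 + 3229275*b^5 + 16424247*b^4 + 50489250*b^3 +
    89880210*b^2 + 87198300*b + 35910000)*y^3 + (2100*b^8 + 50715*b^7 + 763629*b^6 + 7563785*b^5 +
    35168141*b^4 + 93768320*b^3 + 150201450*b^2 + 130882500*b + 47250000)*y^2 + (4900*b^8 +
    139405*b^7 + 1547577*b^6 + 9209045*b^5 + 36563153*b^4 + 91164270*b^3 + 130903290*b^2 +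
    98746200*b + 30240000)*y + 2100*b^8 + 71190*b^7 + 874440*b^6 + 5418000*b^5 + 19000800*b^4 +
    39114810*b^3 + 46499460*b^2 + 29332800*b + 7560000)"
    using \<open>b > 0\<close> \<open>y \<ge> 0\<close> by (intro mult_nonneg_nonneg add_nonneg_nonneg) simp_all
  also have "\<dots> = 100 * psum4 b x -
      21 * (b + 1) * (b + 5) * ((5 * b + 12) * x * (25 * x + 8 * b)) * psum3 b x"
    unfolding psum3_def psum4_def \<open>x = y + 1\<close> by algebra
  finally show ?thesis by simp
qed

text \<open>The quotient p_5 / p_4 inherits 7 b + 24 from the leading coefficient of
  \<open>psum5\<close> and 5 b + 12 from that of \<open>psum4\<close>, which explains why the latter
  sits in the denominator of the bound.\<close>

lemma psum5_ge:
  fixes b x :: real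
  assumes "b > 0" "x \<ge> 1"
  shows "(b + 7) * (2 * (7 * b + 24) * x * (84 * x + 25 * b)) * psum4 b x
    \<le> 70 * (5 * b + 12) * psum5 b x"
proof -
  define y where "y = x - 1"
  have "y \<ge> 0" "x = y + 1" using assms by (auto simp: y_def)
  have "0 \<le> (y + 1) * (y + 2) * ((129850*b^8 + 2129330*b^7 + 16277660*b^6 + 86512300*b^5 +
      345797130*b^4 + 949850370*b^3 +
    1611701280*b^2 + 1468847520*b + 533433600)*y^7 + (183330*b^9 + 3188040*b^8 + 32174160*b^7 +
    240226740*b^6 + 1266397590*b^5 + 4557230580*b^4 + 10920301560*b^3 + 16617318480*b^2 +
    14421758400*b + 5334336000)*y^6 + (55608*b^10 + 1177806*b^9 + 20938676*b^8 + 228035464*b^7 +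
    1600174300*b^6 + 7663916450*b^5 + 24990552216*b^4 + 54392650200*b^3 + 75895641360*b^2 +
    61780501440*b + 22404211200)*y^5 + (142632*b^10 + 6061314*b^9 + 89456284*b^8 + 882185936*b^7 +
    5812365320*b^6 + 25562640010*b^5 + 76093515204*b^4 + 152305235460*b^3 + 197027888400*b^2 +
    149633205120*b + 51209625600)*y^4 + (7350*b^11 + 407526*b^10 + 12731082*b^9 + 228596562*b^8 +
    2119719108*b^7 + 12620367510*b^6 + 51007405950*b^5 + 140452079922*b^4 + 260431882830*b^3 +
    312719536080*b^2 + 219975950880*b + 68812934400)*y^3 + (26950*b^11 + 1293488*b^10 +
    27089776*b^9 + 337211956*b^8 + 2945896934*b^7 + 16599472620*b^6 + 61980951920*b^5 +
    158150143536*b^4 + 272990006100*b^3 + 303075047520*b^2 + 194453058240*b + 54410227200)*y^2 +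
    (26950*b^11 + 1441496*b^10 + 30604252*b^9 + 352646132*b^8 + 2488337878*b^7 + 12220145960*b^6 +
    42598433040*b^5 + 102316900812*b^4 + 163434451320*b^3 + 165046835520*b^2 + 94857194880*b +
    23471078400)*y + 7350*b^11 + 437010*b^10 + 9906120*b^9 + 120379140*b^8 + 894149550*b^7 +
    4317412050*b^6 + 13926847620*b^5 + 30139518360*b^4 + 42993291600*b^3 + 38553459840*b^2 +
    19574472960*b + 4267468800)"
    using \<open>b > 0\<close> \<open>y \<ge> 0\<close> by (intro mult_nonneg_nonneg add_nonneg_nonneg) simp_all
  also have "\<dots> = 70 * (5 * b + 12) * psum5 b x -
      (b + 7) * (2 * (7 * b + 24) * x * (84 * x + 25 * b)) * psum4 b x"
    unfolding psum4_def psum5_def \<open>x = y + 1\<close> by algebra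
  finally show ?thesis by simp
qed

lemma psum6_ge:
  fixes b x :: real
  assumes "b > 0" "x \<ge> 1"
  shows "55 * (b + 1) * (b + 3) * (b + 9) * ((21 * b^3 + 236 * b^2 + 856 * b + 960) * x * (7 * x +
      2 * b)) * psum5 b x
    \<le> 21 * (7 * b + 24) * psum6 b x"
proof -
  define y where "y = x - 1"
  have "y \<ge> 0" "x = y + 1" using assms by (auto simp: y_def)
  have "0 \<le> (y + 1) * (y + 2) * ((3128160*b^13 + 116263280*b^12 + 1988081620*b^11 +
      21102099620*b^10 + 157521933940*b^9 +
    879576036500*b^8 + 3768921407020*b^7 + 12408373123020*b^6 + 30888195414300*b^5 +
    56418683248620*b^4 + 72303376012560*b^3 + 60744201708960*b^2 + 29689237670400*b +
    6337191168000)*y^9 + (6055665*b^14 + 229578475*b^13 + 4248134415*b^12 + 51651057885*b^11 +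
    459123758289*b^10 + 3103032044847*b^9 + 16133938285521*b^8 + 64576774016447*b^7 +
    197852553515610*b^6 + 458326877804586*b^5 + 785305535650020*b^4 + 959024504259360*b^3 +
    783623275253280*b^2 + 380679097075200*b + 82383485184000)*y^8 + (3476550*b^15 + 137855025*b^14
    + 3002636035*b^13 + 45471158355*b^12 + 504908745705*b^11 + 4202316558573*b^10 +
    26620086015579*b^9 + 129515309445417*b^8 + 485214323043989*b^7 + 1394465427189030*b^6 +
    3041468021810862*b^5 + 4935267521775360*b^4 + 5757928387429680*b^3 + 4550155032709440*b^2 +
    2170598624409600*b + 468952146432000)*y^7 + (544005*b^16 + 26969415*b^15 + 896290560*b^14 +
    18910643260*b^13 + 271041624135*b^12 + 2818607029305*b^11 + 22005157009518*b^10 +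
    131049590764434*b^9 + 600043645034982*b^8 + 2118065032635134*b^7 + 5748063735010320*b^6 +
    11878952974885332*b^5 + 18344249950617360*b^4 + 20478424565380320*b^3 + 15589734510208320*b^2 +
    7227043457356800*b + 1533600262656000)*y^6 + (2010855*b^16 + 137591355*b^15 + 3942488220*b^14 +
    74584780750*b^13 + 1007134704915*b^12 + 9938430070575*b^11 + 73319947253790*b^10 +
    411913996218720*b^9 + 1781493161929500*b^8 + 5953727859910820*b^7 + 15335387210363340*b^6 +
    30155912450010900*b^5 + 44431021765150020*b^4 + 47459049962773680*b^3 + 34673250788336160*b^2 +
    15476341233830400*b + 3174932775168000)*y^5 + (48510*b^17 + 5964420*b^16 + 338424900*b^15 +
    10719668850*b^14 + 199584531460*b^13 + 2522771332425*b^12 + 23294501085165*b^11 +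
    162035728453986*b^10 + 861912294966978*b^9 + 3536639547143889*b^8 + 11234033181780893*b^7 +
    27556656670038690*b^6 + 51692307387226254*b^5 + 72736776069845580*b^4 + 74235977629561440*b^3 +
    51812647556614560*b^2 + 22071999270182400*b + 4315627185408000)*y^4 + (242550*b^17 +
    20300280*b^16 + 798423384*b^15 + 19569475992*b^14 + 338928322756*b^13 + 4131783915397*b^12 +
    36399118045811*b^11 + 239821806013156*b^10 + 1209378763403210*b^9 + 4719741667923841*b^8 +
    14294097850587511*b^7 + 33472868214460854*b^6 + 59962746424881258*b^5 + 80523390467797200*b^4 +
    78291749991082320*b^3 + 51901425644302080*b^2 + 20918635507123200*b + 3853012230144000)*y^3 +
    (388080*b^17 + 33671715*b^16 + 1265322003*b^15 + 27943481049*b^14 + 410924506527*b^13 +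
    4442664091149*b^12 + 36491618905407*b^11 + 228943419261915*b^10 + 1103038928565789*b^9 +
    4110938759173584*b^8 + 11894086206366606*b^7 + 26617121747962668*b^6 + 45514095038490708*b^5 +
    58172212459579680*b^4 + 53604993542395680*b^3 + 33513477064784640*b^2 + 12674040328857600*b +
    2179993761792000)*y^2 + (226380*b^17 + 21447195*b^16 + 849091353*b^15 + 19331273379*b^14 +
    288195985197*b^13 + 2987377091649*b^12 + 22720214177547*b^11 + 132099106084293*b^10 +
    599625546036843*b^9 + 2133532349808576*b^8 + 5917784581962000*b^7 + 12663821653712028*b^6 +
    20597232126318120*b^5 + 24893479768116960*b^4 + 21569912146157760*b^3 + 12616623700369920*b^2 +
    4444765058764800*b + 709765410816000)*y + 48510*b^17 + 4830210*b^16 + 196714980*b^15 +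
    4574243520*b^14 + 69548163300*b^13 + 742405563900*b^12 + 5801098343040*b^11 +
    34036278950520*b^10 + 152217060527070*b^9 + 522758505716370*b^8 + 1380134604936780*b^7 +
    2786850511414200*b^6 + 4252524851448720*b^5 + 4801034190395520*b^4 + 3872523621859200*b^3 +
    2102716960565760*b^2 + 686267508326400*b + 101395058688000)"
    using \<open>b > 0\<close> \<open>y \<ge> 0\<close> by (intro mult_nonneg_nonneg add_nonneg_nonneg) simp_all
  also have "\<dots> = 21 * (7 * b + 24) * psum6 b x -
      55 * (b + 1) * (b + 3) * (b + 9) * ((21 * b^3 + 236 * b^2 + 856 * b + 960) * x * (7 * x + 2
          * b)) * psum5 b x"
    unfolding psum5_def psum6_def \<open>x = y + 1\<close> by algebra
  finally show ?thesis by simp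
qed

section \<open>The bounds\<close>

text \<open>The k-th power removes all fractional exponents. What remains is a denominator-free
  identity in b and n, which \<open>algebra\<close> can later match with the bound on the power
  sum.\<close>

lemma markov_upper_sq_3:
  fixes b :: real and n :: nat
  assumes "b > 0"
  defines "C \<equiv> markov_upper_sq n 3 (b - 1)"
  shows "C > 0" "125 * b^3 * (b + 2) * (b + 4) * C^3 = (real n + 1)^3 * (5 * real n + 2 * b)^3"
proof -
  have shift: "b - 1 + 1 = b" "b - 1 + 3 = b + 2" "b - 1 + 5 = b + 4"
    by simp_all
  define w v where "w = real n + 1" and "v = 5 * real n + 2 * b"
  have wv: "w > 0" "v > 0" "real n + 1 = w" "real n + 2 * b / 5 = v / 5"
    using \<open>b > 0\<close> by (auto simp: w_def v_def field_simps intro: add_nonneg_pos)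
  have C: "C = (real n + 1) * (real n + 2 * b / 5)
      / (b * ((b + 2) * (b + 4)) powr (1 / 3))"
    unfolding C_def markov_upper_sq_def shift by simp
  show "C > 0"
    unfolding C wv(3,4) using wv(1,2) \<open>b > 0\<close> by (simp add: add_pos_pos)
  have "C^3 = (w * (v / 5))^3 / (b^3 * ((b + 2) * (b + 4)))"
    unfolding C wv(3,4) using \<open>b > 0\<close>
    by (simp add: power_divide power_mult_distrib powr_power powr_mult add_pos_pos)
  also have "b^3 * ((b + 2) * (b + 4)) = b^3 * (b + 2) * (b + 4)"
    by algebra
  finally show "125 * b^3 * (b + 2) * (b + 4) * C^3 = (real n + 1)^3 * (5 * real n + 2 * b)^3"
    unfolding wv(3) v_def[symmetric] using \<open>b > 0\<close> by (simp add: power_mult_distrib power_divide)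
qed

lemma markov_upper_sq_4:
  fixes b :: real and n :: nat
  assumes "b > 0"
  defines "C \<equiv> markov_upper_sq n 4 (b - 1)"
  shows "C > 0" "4802 * b^4 * (b + 2)^2 * (b + 4) * (b + 6) * C^4 = (5 * b + 12) * (real n + 1)^4
      * (7 * real n + 3 * b)^4"
proof -
  have shift: "b - 1 + 1 = b" "b - 1 + 3 = b + 2" "b - 1 + 5 = b + 4" "b - 1 + 7 = b + 6" "5 * (b
      - 1) + 17 = 5 * b + 12"
    by simp_all
  define w v where "w = real n + 1" and "v = 7 * real n + 3 * b"
  have wv: "w > 0" "v > 0" "real n + 1 = w" "real n + 3 * b / 7 = v / 7"
    using \<open>b > 0\<close> by (auto simp: w_def v_def field_simps intro: add_nonneg_pos)
  have C: "C = (5 * b + 12) powr (1 / 4) * (real n + 1) * (real n + 3 * b / 7)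
      / (b * (b + 2) powr (1 / 2) * (2 * (b + 4) * (b + 6)) powr (1 / 4))"
    unfolding C_def markov_upper_sq_def shift by simp
  show "C > 0"
    unfolding C wv(3,4) using wv(1,2) \<open>b > 0\<close> by (simp add: add_pos_pos)
  have "C^4 = (5 * b + 12) * (w * (v / 7))^4 / (b^4 * (b + 2)^2 * (2 * (b + 4) * (b + 6)))"
    unfolding C wv(3,4) using \<open>b > 0\<close>
    by (simp add: power_divide power_mult_distrib powr_power powr_mult add_pos_pos)
  also have "b^4 * (b + 2)^2 * (2 * (b + 4) * (b + 6)) = 2 * b^4 * (b + 2)^2 * (b + 4) * (b + 6)"
    by algebra
  finally show "4802 * b^4 * (b + 2)^2 * (b + 4) * (b + 6) * C^4 = (5 * b + 12) * (real n + 1)^4 *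
      (7 * real n + 3 * b)^4"
    unfolding wv(3) v_def[symmetric] using \<open>b > 0\<close> by (simp add: power_mult_distrib power_divide)
qed

lemma markov_upper_sq_5:
  fixes b :: real and n :: nat
  assumes "b > 0"
  defines "C \<equiv> markov_upper_sq n 5 (b - 1)"
  shows "C > 0" "59049 * b^5 * (b + 2)^2 * (b + 4) * (b + 6) * (b + 8) * C^5 = (7 * b + 24) *
      (real n + 1)^5 * (9 * real n + 4 * b)^5"
proof -
  have shift: "b - 1 + 1 = b" "b - 1 + 3 = b + 2" "b - 1 + 5 = b + 4" "b - 1 + 7 = b + 6" "b - 1 +
      9 = b + 8"
    "5 * (b - 1) + 17 = 5 * b + 12" "7 * (b - 1) + 31 = 7 * b + 24"
    by simp_all
  define w v where "w = real n + 1" and "v = 9 * real n + 4 * b"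
  have wv: "w > 0" "v > 0" "real n + 1 = w" "real n + 4 * b / 9 = v / 9"
    using \<open>b > 0\<close> by (auto simp: w_def v_def field_simps intro: add_nonneg_pos)
  have C: "C = (7 * b + 24) powr (1 / 5) * (real n + 1) * (real n + 4 * b / 9)
      / (b * (b + 2) powr (2 / 5) * ((b + 4) * (b + 6) * (b + 8)) powr (1 / 5))"
    unfolding C_def markov_upper_sq_def shift by simp
  show "C > 0"
    unfolding C wv(3,4) using wv(1,2) \<open>b > 0\<close> by (simp add: add_pos_pos)
  have "C^5 = (7 * b + 24) * (w * (v / 9))^5 / (b^5 * (b + 2)^2 * ((b + 4) * (b + 6) * (b + 8)))"
    unfolding C wv(3,4) using \<open>b > 0\<close>
    by (simp add: power_divide power_mult_distrib powr_power powr_mult add_pos_pos)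
  also have "b^5 * (b + 2)^2 * ((b + 4) * (b + 6) * (b + 8)) = b^5 * (b + 2)^2 * (b + 4) * (b + 6)
      * (b + 8)"
    by algebra
  finally show "59049 * b^5 * (b + 2)^2 * (b + 4) * (b + 6) * (b + 8) * C^5 = (7 * b + 24) * (real
      n + 1)^5 * (9 * real n + 4 * b)^5"
    unfolding wv(3) v_def[symmetric] using \<open>b > 0\<close> by (simp add: power_mult_distrib power_divide)
qed

lemma markov_upper_sq_6:
  fixes b :: real and n :: nat
  assumes "b > 0"
  defines "C \<equiv> markov_upper_sq n 6 (b - 1)"
  shows "C > 0" "1771561 * b^6 * (b + 2)^3 * (b + 4)^2 * (b + 6) * (b + 8) * (b + 10) * C^6 = (21
      * b^3 + 236 * b^2 + 856 * b + 960) * (real n + 1)^6 * (11 * real n + 5 * b)^6"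
proof -
  \<comment> \<open>The last equation re-expands the cubic of the theorem in b = \<alpha> +
    1.\<close>
  have shift: "b - 1 + 1 = b" "b - 1 + 3 = b + 2" "b - 1 + 5 = b + 4" "b - 1 + 7 = b + 6" "b - 1 +
      9 = b + 8"
    "b - 1 + 11 = b + 10" "7 * (b - 1) + 31 = 7 * b + 24"
    "21 * (b - 1)^3 + 299 * (b - 1)^2 + 1391 * (b - 1) + 2073 = 21 * b^3 + 236 * b^2 + 856 * b +
        960"
    by (simp, simp, simp, simp, simp, simp, simp, algebra)
  define w v where "w = real n + 1" and "v = 11 * real n + 5 * b"
  have wv: "w > 0" "v > 0" "real n + 1 = w" "real n + 5 * b / 11 = v / 11"
    using \<open>b > 0\<close> by (auto simp: w_def v_def field_simps intro: add_nonneg_pos)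
  have C: "C = (21 * b^3 + 236 * b^2 + 856 * b + 960) powr (1 / 6) * (real n + 1) * (real n + 5 *
      b / 11)
      / (b * (b + 2) powr (1 / 2) * (b + 4) powr (1 / 3)
         * ((b + 6) * (b + 8) * (b + 10)) powr (1 / 6))"
    unfolding C_def markov_upper_sq_def shift by simp
  \<comment> \<open>Cancelling the exponent 1/6 against the sixth power requires a positive
    base.\<close>
  have pos: "21 * b^3 + 236 * b^2 + 856 * b + 960 > 0" "21 * b^3 + 236 * b^2 + 856 * b + 960 \<noteq> 0"
    using \<open>b > 0\<close> by (simp_all add: add_pos_pos less_imp_neq[THEN not_sym])
  show "C > 0"
    unfolding C wv(3,4) using wv(1,2) \<open>b > 0\<close> pos by (simp add: add_pos_pos)
  have "C^6 = (21 * b^3 + 236 * b^2 + 856 * b + 960) * (w * (v / 11))^6 / (b^6 * (b + 2)^3 * (b +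
      4)^2 * ((b + 6) * (b + 8) * (b + 10)))"
    unfolding C wv(3,4) using \<open>b > 0\<close> pos
    by (simp add: power_divide power_mult_distrib powr_power powr_mult add_pos_pos)
  also have "b^6 * (b + 2)^3 * (b + 4)^2 * ((b + 6) * (b + 8) * (b + 10)) = b^6 * (b + 2)^3 * (b +
      4)^2 * (b + 6) * (b + 8) * (b + 10)"
    by algebra
  finally show "1771561 * b^6 * (b + 2)^3 * (b + 4)^2 * (b + 6) * (b + 8) * (b + 10) * C^6 = (21 *
      b^3 + 236 * b^2 + 856 * b + 960) * (real n + 1)^6 * (11 * real n + 5 * b)^6"
    unfolding wv(3) v_def[symmetric] using \<open>b > 0\<close> by (simp add: power_mult_distrib power_divide)
qed

section \<open>Transfer of the inequalities to the Markov constant\<close>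

context laguerre
begin

text \<open>Positivity of the ground state needs the bound for all \<open>j \<le> n\<close>, not only for \<open>n\<close>; it
  follows because the bounding polynomial is monotone.\<close>

lemma markov_const_le_of_power_sum:
  assumes "k > 0" "C > 0" "D > 0" "a > 0" "G \<ge> 0" "q \<ge> 0" "r \<ge> 0"
    and psum: "\<And>j. D * power_sum (evs j) k = P (real j)"
    and P0: "P 0 = 0" and P: "\<And>x. x \<ge> 1 \<Longrightarrow> a * P x \<le> G * (x + 1)^k * (q * x + r)^k"
    and C: "a * D * C^k = G * (real n + 1)^k * (q * real n + r)^k"
  shows "markov_const n \<alpha> \<le> ereal (sqrt C)"
proof (rule markov_const_le_power_sum[OF \<open>C > 0\<close> \<open>k > 0\<close>])
  fix j assume "j \<le> n"
  have "a * P (real j) \<le> G * (real n + 1)^k * (q * real n + r)^k"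
  \<comment> \<open>The polynomial inequality is available only from x = 1 on; at j = 0 the power
    sum is empty and its closed form is 0.\<close>
  proof (cases "j = 0")
    case True
    then show ?thesis using assms(5-7) by (simp add: P0)
  next
    case False
    then have "a * P (real j) \<le> G * (real j + 1)^k * (q * real j + r)^k" by (intro P) simp
    also have "\<dots> \<le> G * (real n + 1)^k * (q * real n + r)^k"
      using \<open>j \<le> n\<close> assms(5-7) by (intro mult_mono power_mono add_mono) auto
    finally show ?thesis .
  qed
  then have "(a * D) * power_sum (evs j) k \<le> (a * D) * C^k"
    by (simp only: C) (simp only: mult.assoc psum)
  then show "power_sum (evs j) k \<le> C^k"
    using \<open>a > 0\<close> \<open>D > 0\<close> by simp
qed

text \<open>The equation for C says that C is the factor A / A' corrected by the two normalisers, so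
  the polynomial inequality becomes the comparison of consecutive power sums.\<close>

lemma markov_const_ge_of_power_sum:
  assumes "n > 0"
    and psum: "D * power_sum (evs n) k = P" "D' * power_sum (evs n) (Suc k) = P'"
    and le: "A * P \<le> A' * P'" and A': "A' * D' > 0" and C: "A * D = A' * D' * C"
  shows "ereal (sqrt C) \<le> markov_const n \<alpha>"
proof (rule markov_const_ge_power_sum)
  \<comment> \<open>p_1 is positive by its closed form, so the list of eigenvalues is nonempty and
    all its power sums are positive.\<close>
  have "2 * (\<alpha> + 1) * power_sum (evs n) 1 > 0"
    using \<open>n > 0\<close> by (simp only: power_sum_evs_1 psum1_def) simp
  then have "evs n \<noteq> []" by (auto simp: power_sum_def)
  then show "power_sum (evs n) k > 0"
    unfolding power_sum_def using evs(1)[of n] by (cases "evs n") (auto intro!: add_pos_nonneg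
        sum_list_nonneg zero_le_power simp: less_imp_le)
  have "(A' * D') * (C * power_sum (evs n) k) \<le> (A' * D') * power_sum (evs n) (Suc k)"
    using le unfolding psum[symmetric] mult.assoc[symmetric] C .
  then show "C * power_sum (evs n) k \<le> power_sum (evs n) (Suc k)"
    by (simp only: mult_le_cancel_left_pos[OF A'])
qed

lemma markov_const_le_3: "markov_const n \<alpha> \<le> ereal (sqrt (markov_upper_sq n 3 \<alpha>))"
proof -
  define b where "b = \<alpha> + 1"
  have "b > 0" "\<alpha> = b - 1" using \<alpha> by (auto simp: b_def)
  note C = markov_upper_sq_3[OF \<open>b > 0\<close>, of n, folded \<open>\<alpha> = b - 1\<close>]
  show ?thesis
  proof (rule markov_const_le_of_power_sum)
    show "20 * b^3 * (b + 1) * (b + 2) * (b + 3) * (b + 4) * power_sum (evs j) 3 = psum3 b (real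
        j)" for j
      unfolding b_def by (rule power_sum_evs_3)
    show "25 * psum3 b x
        \<le> (4 * (b + 1) * (b + 3)) * (x + 1)^3 * (5 * x + 2 * b)^3" if "x \<ge> 1" for x
      by (rule psum3_le[OF \<open>b > 0\<close> that])
    \<comment> \<open>This is \<open>C(2)\<close> times \<open>4 * (b + 1) * (b + 3)\<close>: the
      factors b + 1 and b + 3 of the normaliser also divide the leading coefficient of
      \<open>psum3\<close> and so are absent from the bound.\<close>
    show "25 * (20 * b^3 * (b + 1) * (b + 2) * (b + 3) * (b + 4)) * markov_upper_sq n 3 \<alpha> ^ 3 =
        (4 * (b + 1) * (b + 3)) * (real n + 1)^3 * (5 * real n + 2 * b)^3"
      using C(2) by algebra
  qed (use C(1) \<open>b > 0\<close> in \<open>simp_all add: psum3_def add_pos_pos\<close>)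
qed

lemma markov_const_ge_3:
  assumes "n \<ge> 3"
  shows "ereal (sqrt (markov_lower_sq n 3 \<alpha>)) \<le> markov_const n \<alpha>"
proof -
  define b where "b = \<alpha> + 1"
  have "b > 0" "\<alpha> = b - 1" using \<alpha> by (auto simp: b_def)
  have shift: "b - 1 + 1 = b" "b - 1 + 3 = b + 2" "b - 1 + 5 = b + 4"
    by simp_all
  \<comment> \<open>Naming the fractional factor isolates its division, so that clearing the
    denominator leaves a purely polynomial equation for \<open>algebra\<close>.\<close>
  define r where "r = real n + 3 * b / 8"
  have r: "8 * r = 8 * real n + 3 * b"
    by (simp add: r_def)
  have "markov_lower_sq n 3 \<alpha> = 2 * real n * r
      / (b * (b + 4))"
    unfolding markov_lower_sq_def \<open>\<alpha> = b - 1\<close> shift r_def by simp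
  moreover have "b * (b + 4) \<noteq> 0"
    using \<open>b > 0\<close> by simp
  ultimately have "markov_lower_sq n 3 \<alpha> * (b * (b + 4)) = 2 * real n * r"
    by (simp only: times_divide_eq_left nonzero_mult_div_cancel_right not_False_eq_True)
  then have C: "8 * b * (b + 4) * markov_lower_sq n 3 \<alpha> = 2 * real n * (8 * real n + 3 * b)"
    using r by algebra
  show ?thesis
  proof (rule markov_const_ge_of_power_sum)
    show "6 * b^2 * (b + 1) * (b + 2) * power_sum (evs n) 2 = psum2 b (real n)"
      unfolding b_def by (rule power_sum_evs_2)
    show "20 * b^3 * (b + 1) * (b + 2) * (b + 3) * (b + 4) * power_sum (evs n) (Suc 2) = psum3 b
        (real n)"
      using power_sum_evs_3[of n] by (simp add: b_def)
    show "5 * (b + 3) * (2 * real n * (8 * real n + 3 * b)) * psum2 b (real n)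
        \<le> 12 * psum3 b (real n)"
      using \<open>n \<ge> 3\<close> by (intro psum3_ge[OF \<open>b > 0\<close>]) simp
    show "5 * (b + 3) * (2 * real n * (8 * real n + 3 * b)) * (6 * b^2 * (b + 1) * (b + 2)) =
        12 * (20 * b^3 * (b + 1) * (b + 2) * (b + 3) * (b + 4)) * markov_lower_sq n 3 \<alpha>"
      using C by algebra
  qed (use \<open>n \<ge> 3\<close> \<open>b > 0\<close> in simp_all)
qed

lemma markov_const_le_4: "markov_const n \<alpha> \<le> ereal (sqrt (markov_upper_sq n 4 \<alpha>))"
proof -
  define b where "b = \<alpha> + 1"
  have "b > 0" "\<alpha> = b - 1" using \<alpha> by (auto simp: b_def)
  note C = markov_upper_sq_4[OF \<open>b > 0\<close>, of n, folded \<open>\<alpha> = b - 1\<close>]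
  show ?thesis
  proof (rule markov_const_le_of_power_sum)
    show "210 * b^4 * (b + 1)^2 * (b + 2)^2 * (b + 3) * (b + 4) * (b + 5) * (b + 6) * power_sum
        (evs j) 4 = psum4 b (real j)" for j
      unfolding b_def by (rule power_sum_evs_4)
    show "343 * psum4 b x
        \<le> (15 * (b + 1)^2 * (b + 3) * (b + 5) * (5 * b + 12)) * (x + 1)^4 * (7 * x + 3 * b)^4" if
            "x \<ge> 1" for x
      by (rule psum4_le[OF \<open>b > 0\<close> that])
    show "343 * (210 * b^4 * (b + 1)^2 * (b + 2)^2 * (b + 3) * (b + 4) * (b + 5) * (b + 6)) *
        markov_upper_sq n 4 \<alpha> ^ 4 =
        (15 * (b + 1)^2 * (b + 3) * (b + 5) * (5 * b + 12)) * (real n + 1)^4 * (7 * real n + 3 *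
            b)^4"
      using C(2) by algebra
  qed (use C(1) \<open>b > 0\<close> in \<open>simp_all add: psum4_def add_pos_pos\<close>)
qed

lemma markov_const_ge_4:
  assumes "n \<ge> 1"
  shows "ereal (sqrt (markov_lower_sq n 4 \<alpha>)) \<le> markov_const n \<alpha>"
proof -
  define b where "b = \<alpha> + 1"
  have "b > 0" "\<alpha> = b - 1" using \<alpha> by (auto simp: b_def)
  have shift: "b - 1 + 1 = b" "b - 1 + 3 = b + 2" "b - 1 + 5 = b + 4" "b - 1 + 7 = b + 6" "5 * (b
      - 1) + 17 = 5 * b + 12"
    by simp_all
  define r where "r = real n + 8 * b / 25"
  have r: "25 * r = 25 * real n + 8 * b"
    by (simp add: r_def)
  have "markov_lower_sq n 4 \<alpha> = (5 * b + 12) * real n * r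
      / (2 * b * (b + 2) * (b + 6))"
    unfolding markov_lower_sq_def \<open>\<alpha> = b - 1\<close> shift r_def by simp
  moreover have "2 * b * (b + 2) * (b + 6) \<noteq> 0"
    using \<open>b > 0\<close> by simp
  ultimately have "markov_lower_sq n 4 \<alpha> * (2 * b * (b + 2) * (b + 6)) = (5 * b + 12) * real n * r"
    by (simp only: times_divide_eq_left nonzero_mult_div_cancel_right not_False_eq_True)
  then have C: "50 * b * (b + 2) * (b + 6) * markov_lower_sq n 4 \<alpha> = (5 * b + 12) * real n * (25 *
      real n + 8 * b)"
    using r by algebra
  show ?thesis
  proof (rule markov_const_ge_of_power_sum)
    show "20 * b^3 * (b + 1) * (b + 2) * (b + 3) * (b + 4) * power_sum (evs n) 3 = psum3 b (real n)"
      unfolding b_def by (rule power_sum_evs_3)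
    show "210 * b^4 * (b + 1)^2 * (b + 2)^2 * (b + 3) * (b + 4) * (b + 5) * (b + 6) * power_sum
        (evs n) (Suc 3) = psum4 b (real n)"
      using power_sum_evs_4[of n] by (simp add: b_def)
    show "21 * (b + 1) * (b + 5) * ((5 * b + 12) * real n * (25 * real n + 8 * b)) * psum3 b (real
        n)
        \<le> 100 * psum4 b (real n)"
      using \<open>n \<ge> 1\<close> by (intro psum4_ge[OF \<open>b > 0\<close>]) simp
    show "21 * (b + 1) * (b + 5) * ((5 * b + 12) * real n * (25 * real n + 8 * b)) * (20 * b^3 *
        (b + 1) * (b + 2) * (b + 3) * (b + 4)) =
        100 * (210 * b^4 * (b + 1)^2 * (b + 2)^2 * (b + 3) * (b + 4) * (b + 5) * (b + 6)) *
            markov_lower_sq n 4 \<alpha>"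
      using C by algebra
  qed (use \<open>n \<ge> 1\<close> \<open>b > 0\<close> in simp_all)
qed

lemma markov_const_le_5: "markov_const n \<alpha> \<le> ereal (sqrt (markov_upper_sq n 5 \<alpha>))"
proof -
  define b where "b = \<alpha> + 1"
  have "b > 0" "\<alpha> = b - 1" using \<alpha> by (auto simp: b_def)
  note C = markov_upper_sq_5[OF \<open>b > 0\<close>, of n, folded \<open>\<alpha> = b - 1\<close>]
  show ?thesis
  proof (rule markov_const_le_of_power_sum)
    show "252 * b^5 * (b + 1)^2 * (b + 2)^2 * (b + 3) * (b + 4) * (b + 5) * (b + 6) * (b + 7) * (b
        + 8) * power_sum (evs j) 5 = psum5 b (real j)" for j
      unfolding b_def by (rule power_sum_evs_5)
    show "6561 * psum5 b x
        \<le> (28 * (b + 1)^2 * (b + 3) * (b + 5) * (b + 7) * (7 * b + 24)) * (x + 1)^5 * (9 * x + 4 *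
            b)^5" if "x \<ge> 1" for x
      by (rule psum5_le[OF \<open>b > 0\<close> that])
    show "6561 * (252 * b^5 * (b + 1)^2 * (b + 2)^2 * (b + 3) * (b + 4) * (b + 5) * (b + 6) * (b +
        7) * (b + 8)) * markov_upper_sq n 5 \<alpha> ^ 5 =
        (28 * (b + 1)^2 * (b + 3) * (b + 5) * (b + 7) * (7 * b + 24)) * (real n + 1)^5 * (9 * real
            n + 4 * b)^5"
      using C(2) by algebra
  qed (use C(1) \<open>b > 0\<close> in \<open>simp_all add: psum5_def add_pos_pos\<close>)
qed

lemma markov_const_ge_5:
  assumes "n \<ge> 1"
  shows "ereal (sqrt (markov_lower_sq n 5 \<alpha>)) \<le> markov_const n \<alpha>"
proof -
  define b where "b = \<alpha> + 1"
  have "b > 0" "\<alpha> = b - 1" using \<alpha> by (auto simp: b_def)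
  have shift: "b - 1 + 1 = b" "b - 1 + 3 = b + 2" "b - 1 + 5 = b + 4" "b - 1 + 7 = b + 6" "b - 1 +
      9 = b + 8"
    "5 * (b - 1) + 17 = 5 * b + 12" "7 * (b - 1) + 31 = 7 * b + 24"
    by simp_all
  define r where "r = real n + 25 * b / 84"
  have r: "84 * r = 84 * real n + 25 * b"
    by (simp add: r_def)
  have "markov_lower_sq n 5 \<alpha> = 2 * (7 * b + 24) * real n * r
      / (b * (b + 8) * (5 * b + 12))"
    unfolding markov_lower_sq_def \<open>\<alpha> = b - 1\<close> shift r_def by simp
  moreover have "b * (b + 8) * (5 * b + 12) \<noteq> 0"
    using \<open>b > 0\<close> by simp
  ultimately have "markov_lower_sq n 5 \<alpha> * (b * (b + 8) * (5 * b + 12)) = 2 * (7 * b + 24) * real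
      n * r"
    by (simp only: times_divide_eq_left nonzero_mult_div_cancel_right not_False_eq_True)
  then have C: "84 * b * (b + 8) * (5 * b + 12) * markov_lower_sq n 5 \<alpha> = 2 * (7 * b + 24) * real
      n * (84 * real n + 25 * b)"
    using r by algebra
  show ?thesis
  proof (rule markov_const_ge_of_power_sum)
    show "210 * b^4 * (b + 1)^2 * (b + 2)^2 * (b + 3) * (b + 4) * (b + 5) * (b + 6) * power_sum
        (evs n) 4 = psum4 b (real n)"
      unfolding b_def by (rule power_sum_evs_4)
    show "252 * b^5 * (b + 1)^2 * (b + 2)^2 * (b + 3) * (b + 4) * (b + 5) * (b + 6) * (b + 7) * (b
        + 8) * power_sum (evs n) (Suc 4) = psum5 b (real n)"
      using power_sum_evs_5[of n] by (simp add: b_def)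
    show "(b + 7) * (2 * (7 * b + 24) * real n * (84 * real n + 25 * b)) * psum4 b (real n)
        \<le> 70 * (5 * b + 12) * psum5 b (real n)"
      using \<open>n \<ge> 1\<close> by (intro psum5_ge[OF \<open>b > 0\<close>]) simp
    show "(b + 7) * (2 * (7 * b + 24) * real n * (84 * real n + 25 * b)) * (210 * b^4 * (b + 1)^2
        * (b + 2)^2 * (b + 3) * (b + 4) * (b + 5) * (b + 6)) =
        70 * (5 * b + 12) * (252 * b^5 * (b + 1)^2 * (b + 2)^2 * (b + 3) * (b + 4) * (b + 5) * (b
            + 6) * (b + 7) * (b + 8)) * markov_lower_sq n 5 \<alpha>"
      using C by algebra
  qed (use \<open>n \<ge> 1\<close> \<open>b > 0\<close> in simp_all)
qed

lemma markov_const_le_6: "markov_const n \<alpha> \<le> ereal (sqrt (markov_upper_sq n 6 \<alpha>))"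
proof -
  define b where "b = \<alpha> + 1"
  have "b > 0" "\<alpha> = b - 1" using \<alpha> by (auto simp: b_def)
  note C = markov_upper_sq_6[OF \<open>b > 0\<close>, of n, folded \<open>\<alpha> = b - 1\<close>]
  show ?thesis
  proof (rule markov_const_le_of_power_sum)
    show "4620 * b^6 * (b + 1)^3 * (b + 2)^3 * (b + 3)^2 * (b + 4)^2 * (b + 5) * (b + 6) * (b + 7)
        * (b + 8) * (b + 9) * (b + 10) * power_sum (evs j) 6 = psum6 b (real j)" for j
      unfolding b_def by (rule power_sum_evs_6)
    show "161051 * psum6 b x
        \<le> (420 * (b + 1)^3 * (b + 3)^2 * (b + 5) * (b + 7) * (b + 9) * (21 * b^3 + 236 * b^2 + 856
            * b + 960)) * (x + 1)^6 * (11 * x + 5 * b)^6" if "x \<ge> 1" for x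
      by (rule psum6_le[OF \<open>b > 0\<close> that])
    show "161051 * (4620 * b^6 * (b + 1)^3 * (b + 2)^3 * (b + 3)^2 * (b + 4)^2 * (b + 5) * (b + 6)
        * (b + 7) * (b + 8) * (b + 9) * (b + 10)) * markov_upper_sq n 6 \<alpha> ^ 6 =
        (420 * (b + 1)^3 * (b + 3)^2 * (b + 5) * (b + 7) * (b + 9) * (21 * b^3 + 236 * b^2 + 856 *
            b + 960)) * (real n + 1)^6 * (11 * real n + 5 * b)^6"
      using C(2) by algebra
  qed (use C(1) \<open>b > 0\<close> in \<open>simp_all add: psum6_def add_pos_pos\<close>)
qed

lemma markov_const_ge_6:
  assumes "n \<ge> 1"
  shows "ereal (sqrt (markov_lower_sq n 6 \<alpha>)) \<le> markov_const n \<alpha>"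
proof -
  define b where "b = \<alpha> + 1"
  have "b > 0" "\<alpha> = b - 1" using \<alpha> by (auto simp: b_def)
  have shift: "b - 1 + 1 = b" "b - 1 + 3 = b + 2" "b - 1 + 5 = b + 4" "b - 1 + 7 = b + 6" "b - 1 +
      9 = b + 8"
    "b - 1 + 11 = b + 10" "7 * (b - 1) + 31 = 7 * b + 24"
    "21 * (b - 1)^3 + 299 * (b - 1)^2 + 1391 * (b - 1) + 2073 = 21 * b^3 + 236 * b^2 + 856 * b +
        960"
    by (simp, simp, simp, simp, simp, simp, simp, algebra)
  define r where "r = real n + 2 * b / 7"
  have r: "7 * r = 7 * real n + 2 * b"
    by (simp add: r_def)
  have "markov_lower_sq n 6 \<alpha> = (21 * b^3 + 236 * b^2 + 856 * b + 960) * real n * r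
      / (b * (b + 2) * (b + 4) * (b + 10) * (7 * b + 24))"
    unfolding markov_lower_sq_def \<open>\<alpha> = b - 1\<close> shift r_def by simp
  moreover have "b * (b + 2) * (b + 4) * (b + 10) * (7 * b + 24) \<noteq> 0"
    using \<open>b > 0\<close> by simp
  ultimately have "markov_lower_sq n 6 \<alpha> * (b * (b + 2) * (b + 4) * (b + 10) * (7 * b + 24)) = (21
      * b^3 + 236 * b^2 + 856 * b + 960) * real n * r"
    by (simp only: times_divide_eq_left nonzero_mult_div_cancel_right not_False_eq_True)
  then have C: "7 * b * (b + 2) * (b + 4) * (b + 10) * (7 * b + 24) * markov_lower_sq n 6 \<alpha> = (21
      * b^3 + 236 * b^2 + 856 * b + 960) * real n * (7 * real n + 2 * b)"
    using r by algebra
  show ?thesis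
  proof (rule markov_const_ge_of_power_sum)
    show "252 * b^5 * (b + 1)^2 * (b + 2)^2 * (b + 3) * (b + 4) * (b + 5) * (b + 6) * (b + 7) * (b
        + 8) * power_sum (evs n) 5 = psum5 b (real n)"
      unfolding b_def by (rule power_sum_evs_5)
    show "4620 * b^6 * (b + 1)^3 * (b + 2)^3 * (b + 3)^2 * (b + 4)^2 * (b + 5) * (b + 6) * (b + 7)
        * (b + 8) * (b + 9) * (b + 10) * power_sum (evs n) (Suc 5) = psum6 b (real n)"
      using power_sum_evs_6[of n] by (simp add: b_def)
    show "55 * (b + 1) * (b + 3) * (b + 9) * ((21 * b^3 + 236 * b^2 + 856 * b + 960) * real n * (7
        * real n + 2 * b)) * psum5 b (real n)
        \<le> 21 * (7 * b + 24) * psum6 b (real n)"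
      using \<open>n \<ge> 1\<close> by (intro psum6_ge[OF \<open>b > 0\<close>]) simp
    show "55 * (b + 1) * (b + 3) * (b + 9) * ((21 * b^3 + 236 * b^2 + 856 * b + 960) * real n * (7
        * real n + 2 * b)) * (252 * b^5 * (b + 1)^2 * (b + 2)^2 * (b + 3) * (b + 4) * (b + 5) * (b
        + 6) * (b + 7) * (b + 8)) =
        21 * (7 * b + 24) * (4620 * b^6 * (b + 1)^3 * (b + 2)^3 * (b + 3)^2 * (b + 4)^2 * (b + 5)
            * (b + 6) * (b + 7) * (b + 8) * (b + 9) * (b + 10)) * markov_lower_sq n 6 \<alpha>"
      using C by algebra
  qed (use \<open>n \<ge> 1\<close> \<open>b > 0\<close> in simp_all)
qed

end

theorem theorem1p1:
  fixes \<alpha> :: real and k n :: nat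
  assumes "\<alpha> > -1" and "k \<in> {3, 4, 5, 6}" and "n \<ge> k"
  shows "ereal (markov_lower n k \<alpha>) \<le> markov_const n \<alpha>
       \<and> markov_const n \<alpha> \<le> ereal (markov_upper n k \<alpha>)"
proof -
  interpret laguerre \<alpha> by standard (rule assms(1))
  from assms(2,3) consider "k = 3" "n \<ge> 3" | "k = 4" "n \<ge> 1" | "k = 5" "n \<ge> 1" | "k = 6" "n \<ge> 1"
    by auto
  then show ?thesis
    unfolding markov_lower_def markov_upper_def
    by cases (simp_all add: markov_const_le_3 markov_const_le_4 markov_const_le_5 markov_const_le_6
        markov_const_ge_3 markov_const_ge_4 markov_const_ge_5 markov_const_ge_6)
qed

end
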